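(* Let $\mathcal C_q=\mathcal C_q(\mathbf{ex},\mathcal B,\mathbf{inv},\beta,\lambda)$ be a quantum cluster algebra. Then $\mathcal C_q$ gives rise to an abstract quantum cluster structure $(\mathcal E,\mathcal X,\beta,\lambda,\mathcal A,\langle-,-\rangle)$ with (a) $\mathcal E=\mathcal E(E(\mathcal C_q))$, the signed path category of the directed exchange tree $E(\mathcal C_q)$; (b) $\mathcal X\colon\mathcal E^{op}\to\mathrm{Ab}$ defined by $\mathcal X\underline k=\mathbb Z[\mu_{\underline k}(\mathbf{ex})]$ and, on the two signed arrows $\mu_k^\pm\colon\underline k\to(k,\underline k)$, $\mathcal X(\mu_k^\pm)=\bar\mu_k^\pm\colon\mathbb Z[\mu_{(k,\underline k)}(\mathbf{ex})]\to\mathbb Z[\mu_{\underline k}(\mathbf{ex})]$; (c) $\beta_{\underline k}=\mu_{\underline k}\beta$; (d) $\lambda_{\underline k}=\mu_{\underline k}\lambda$; (e) $\mathcal A\colon\mathcal E\to\mathrm{Ab}$ defined by $\mathcal A\underline k=\mathbb Z[\mu_{\underline k}(\mathcal B)]^*$ and $\mathcal A(\mu_k^\pm)=\mu_k^\pm\colon\mathbb Z[\mu_{\underline k}(\mathcal B)]^*\to\mathbb Z[\mu_{(k,\underline k)}(\mathcal B)]^*$; (f) $\langle-,-\rangle_{\underline k}$ given by $\langle b^*,c\rangle_{\underline k}=b^*(c)$ for $b^*\in\mu_{\underline k}(\mathcal B)^*$, $c\in\mu_{\underline k}(\mathbf{ex})$.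
   Context: Abstract quantum cluster structures. Let $E$ be a simple directed graph (no loops, at most one arrow with given source and target; 2-cycles allowed). $E_\pm$ has the same vertices and two arrows $\alpha^+,\alpha^-\colon c\to d$ for each arrow $\alpha\colon c\to d$ of $E$. The signed path category $\mathcal E(E)$ is the quotient of the path category of $E_\pm$ by $\gamma^-\circ\alpha^+=\mathrm{id}_c=\gamma^+\circ\alpha^-$ whenever $\alpha\colon c\to d$, $\gamma\colon d\to c$ are arrows of $E$. A free abelian sheaf is a functor to Ab of the form $\mathrm{Free}_{\mathbb Z}\circ\mathcal S$ with $\mathcal S$ a Set-valued functor on the same domain and $\mathrm{Free}_{\mathbb Z}\colon\mathrm{Set}\to\mathrm{Ab}$ the free abelian group functor. An abstract cluster structure over $E$ is a tuple $(\mathcal E,\mathcal X,\beta,\mathcal A,\langle-,-\rangle)$ with $\mathcal E=\mathcal E(E)$; $\mathcal X\colon\mathcal E^{op}\to\mathrm{Ab}$ and $\mathcal A\colon\mathcal E\to\mathrm{Ab}$ free abelian sheaves; $\beta\colon\mathcal X\to\mathcal A$ a factorization, i.e. a family $\beta_c\colon\mathcal Xc\to\mathcal Ac$ with $\beta_d=\mathcal Af\circ\beta_c\circ\mathcal Xf$ for all $f\colon c\to d$; and $\langle-,-\rangle$ a right non-degenerate pairing of $\mathcal A$ and $\mathcal X$, i.e. bilinear forms $\langle-,-\rangle_c\colon\mathcal Ac\times\mathcal Xc\to\mathbb Z$ with $\langle a,\mathcal Xf(x)\rangle_c=\langle\mathcal Af(a),x\rangle_d$ for $f\colon c\to d$,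 such that $\delta_{\mathcal Xc}\colon\mathcal Xc\to(\mathcal Ac)^*$, $x\mapsto\langle-,x\rangle_c$, is injective for all $c$; here $A^*=\mathrm{Hom}_{\mathbb Z}(A,\mathbb Z)$. A retraction of $\beta$ is a factorization $\rho\colon\mathcal A\to\mathcal X$ (a family $\rho_c\colon\mathcal Ac\to\mathcal Xc$ with $\rho_c=\mathcal Xf\circ\rho_d\circ\mathcal Af$ for all $f\colon c\to d$) with $\rho_c\circ\beta_c=\mathrm{id}_{\mathcal Xc}$ for all $c$. A quantum structure is a factorization $\lambda\colon\mathcal A\to\mathcal A^*$ (a family $\lambda_c\colon\mathcal Ac\to(\mathcal Ac)^*$ with $\lambda_c=(\mathcal Af)^*\circ\lambda_d\circ\mathcal Af$ for all $f\colon c\to d$) such that $\lambda=\delta_{\mathcal X}\circ\rho$ (i.e. $\lambda_c=\delta_{\mathcal Xc}\circ\rho_c$ for all $c$) for some retraction $\rho$ of $\beta$. An abstract quantum cluster structure is a tuple $(\mathcal E,\mathcal X,\beta,\lambda,\mathcal A,\langle-,-\rangle)$ consisting of an abstract cluster structure together with a quantum structure $\lambda$ for it. Data of a quantum cluster algebra. Countable means finite or countably infinite. $\mathbb Z[S]$ is the free abelian group on $S$. $\mathbb Z[\mathcal B]^*$ is identified with the free abelian group on the dual basis $\mathcal B^*=\{b^*\mid b\in\mathcal B\}$, $b^*(c)=\delta_{bc}$; $\delta\colon\mathbb Z[\mathcal B]\to\mathbb Z[\mathcal B]^{**}$ is the evaluation map, via which $\mathbb Z[\mathcal B]$ is viewed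 in $\mathbb Z[\mathcal B]^{**}$, and $\iota\colon\mathbb Z[\mathbf{ex}]\to\mathbb Z[\mathcal B]$ is the inclusion. The data are: a countable set $\mathcal B$, subsets $\mathbf{ex}\subseteq\mathcal B$ and $\mathbf{inv}\subseteq\mathcal B\setminus\mathbf{ex}$, a homomorphism $\beta\colon\mathbb Z[\mathbf{ex}]\to\mathbb Z[\mathcal B]^*$ that is skew-symmetrizable, a homomorphism $\lambda\colon\mathbb Z[\mathcal B]^*\to\mathbb Z[\mathcal B]$ that is skew-symmetric and compatible with $\beta$, a field $\mathbb K$ and $q^{1/2}\in\mathbb K^\times$. With $\langle v,w\rangle_\beta=\beta(v)(w)$ for $v\in\mathbb Z[\mathbf{ex}],w\in\mathbb Z[\mathcal B]$ and $\langle v,w\rangle_\lambda=w(\lambda(v))$ for $v,w\in\mathbb Z[\mathcal B]^*$: $\beta$ is skew-symmetrizable if $\langle-,-\rangle_\beta$ restricted to $\mathbb Z[\mathbf{ex}]\times\mathbb Z[\mathbf{ex}]$ is skew-symmetric; $\lambda$ is skew-symmetric if $\lambda^*=-\delta\circ\lambda$ (equivalently $\langle-,-\rangle_\lambda$ is skew-symmetric); $\beta$ and $\lambda$ are compatible if $\lambda^*\circ\beta=\delta\circ\iota$ (equivalently $\beta(k)(\lambda(b^* ))=\delta_{bk}$ for $b\in\mathcal B$, $k\in\mathbf{ex}$). Mutation. $[n]_+=\max(n,0)$, $[n]_-=\max(-n,0)$, $[\sum v_bb^*]_\pm=\sum[v_b]_\pm b^*$. For $k\in\mathbf{ex}$ let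 $\mu_{\mathcal B}(k)$ be a new symbol, $\mu_k(\mathcal B)=(\mathcal B\setminus\{k\})\cup\{\mu_{\mathcal B}(k)\}$, $\mu_k(\mathbf{ex})=(\mathbf{ex}\setminus\{k\})\cup\{\mu_{\mathcal B}(k)\}$. Isomorphisms $\mu_k^\pm\colon\mathbb Z[\mathcal B]\to\mathbb Z[\mu_k(\mathcal B)]$: $b\mapsto b+[\langle k,b\rangle_\beta]_\pm\mu_{\mathcal B}(k)$ ($b\ne k$), $k\mapsto-\mu_{\mathcal B}(k)$, with inverses $\bar\mu_k^\pm$: $b\mapsto b+[\langle k,b\rangle_\beta]_\pm k$ ($b\neq\mu_{\mathcal B}(k)$), $\mu_{\mathcal B}(k)\mapsto-k$; these restrict to isomorphisms between $\mathbb Z[\mathbf{ex}]$ and $\mathbb Z[\mu_k(\mathbf{ex})]$. Isomorphisms $\mu_k^\pm\colon\mathbb Z[\mathcal B]^*\to\mathbb Z[\mu_k(\mathcal B)]^*$: $b^*\mapsto b^*$ ($b\neq k$), $k^*\mapsto[\beta(k)]_\pm-\mu_{\mathcal B}(k)^*$, with inverses $\bar\mu_k^\pm$: $b^*\mapsto b^*$ ($b\neq\mu_{\mathcal B}(k)$), $\mu_{\mathcal B}(k)^*\mapsto[\beta(k)]_\pm-k^*$. Define $\mu_k\beta\colon\mathbb Z[\mu_k(\mathbf{ex})]\to\mathbb Z[\mu_k(\mathcal B)]^*$ by $\langle v,w\rangle_{\mu_k\beta}=\langle\bar\mu_k^+v,\bar\mu_k^+w\rangle_\beta$ and $\mu_k\lambda\colon\mathbb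 Z[\mu_k(\mathcal B)]^*\to\mathbb Z[\mu_k(\mathcal B)]$ by $\langle v,w\rangle_{\mu_k\lambda}=\langle\bar\mu_k^+v,\bar\mu_k^+w\rangle_\lambda$. An admissible sequence is a tuple $\underline k=(k_r,\dots,k_1)$ (possibly empty) with $k_1\in\mathbf{ex}$, $k_i\in\mu_{k_{i-1}}(\cdots\mu_{k_1}(\mathbf{ex}))$; $\mu_{\underline k}=\mu_{k_r}\cdots\mu_{k_1}$ denotes iterated mutation of $\mathcal B,\mathbf{ex},\beta,\lambda$ (the maps $\mu_k^\pm,\bar\mu_k^\pm$ at $\underline k$ being formed with $\mu_{\underline k}\beta$). The algebra. The quantum torus $T^\lambda(\mathcal B)$ has $\mathbb K$-basis $\{x^v\mid v\in\mathbb Z[\mathcal B]^*\}$ and product $x^vx^w=q^{\frac12\langle v,w\rangle_\lambda}x^{v+w}$; $\mathcal F(-)$ denotes the skew-field of fractions. For $k\in\mathbf{ex}$, $r^{\mathcal B,k}\colon\mathcal F(T^{\mu_k\lambda}(\mu_k(\mathcal B)))\to\mathcal F(T^\lambda(\mathcal B))$ is the isomorphism with $x^{b^*}\mapsto x^{b^*}$ ($b\ne\mu_{\mathcal B}(k)$) and $x^{\mu_{\mathcal B}(k)^*}\mapsto x^{\bar\mu_k^+(\mu_{\mathcal B}(k)^* )}(1+q^{-1/2}x^{-\beta(k)})$. The quantum cluster variables are the images in $\mathcal F(T^\lambda(\mathcal B))$ of the $x^{b^*}$, $b\in\mu_{\underline k}(\mathcal B)$, under the composites of these isomorphisms along admissible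 sequences $\underline k$. $\mathcal C_q(\mathbf{ex},\mathcal B,\mathbf{inv},\beta,\lambda)$ is the $\mathbb K$-subalgebra generated by all quantum cluster variables, localised at the elements $x^{f^*}$, $f\in\mathbb Z[\mathbf{inv}]$. The directed exchange tree $E(\mathcal C_q)$ has vertices the admissible sequences and an arrow $\mu_k\colon\underline k\to(k,\underline k)$ whenever $(k,\underline k)$ is admissible.
   Formalization: Free abelian sheaf: S assigns sets to objects only, not functorially. Quantum structure: instead of λ=δ_X∘ρ with ρ:A→X, the transpose λ* is a factorization A→A* with λ*∘β=δ_X; as stated the claim fails, since λ∘β=−δ_X and λ need not land in X. *)

theory Defs
  imports
    "HOL-Algebra.Ring"
    "HOL-Algebra.Free_Abelian_Groups"
    "HOL-Library.Countable_Set"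
    "Graph_Theory.Pair_Digraph"
begin

section \<open>Categories and functors to abelian groups\<close>

record ('o, 'm) category =
  Obj :: "'o set"
  Arr :: "'m set"
  Dom :: "'m \<Rightarrow> 'o"
  Cod :: "'m \<Rightarrow> 'o"
  Idm :: "'o \<Rightarrow> 'm"
  Cmp :: "'m \<Rightarrow> 'm \<Rightarrow> 'm"  \<comment> \<open>\<open>Cmp C g f\<close> is \<open>g\<close> after \<open>f\<close>\<close>

definition op_category :: "('o, 'm) category \<Rightarrow> ('o, 'm) category" where
  "op_category C = \<lparr>Obj = Obj C, Arr = Arr C, Dom = Cod C, Cod = Dom C, Idm = Idm C,
     Cmp = (\<lambda>g f. Cmp C f g)\<rparr>"

record ('o, 'm, 'x) ab_functor =
  fobj :: "'o \<Rightarrow> 'x monoid"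
  farr :: "'m \<Rightarrow> 'x \<Rightarrow> 'x"

definition ab_functor :: "('o, 'm) category \<Rightarrow> ('o, 'm, 'x) ab_functor \<Rightarrow> bool" where
  "ab_functor C F \<longleftrightarrow>
     (\<forall>c\<in>Obj C. comm_group (fobj F c)) \<and>
     (\<forall>f\<in>Arr C. farr F f \<in> hom (fobj F (Dom C f)) (fobj F (Cod C f))) \<and>
     (\<forall>c\<in>Obj C. \<forall>x\<in>carrier (fobj F c). farr F (Idm C c) x = x) \<and>
     (\<forall>f\<in>Arr C. \<forall>g\<in>Arr C. Dom C g = Cod C f \<longrightarrow>
        (\<forall>x\<in>carrier (fobj F (Dom C f)). farr F (Cmp C g f) x = farr F g (farr F f x)))"

text \<open>
  A functor whose value on each object is the free abelian group on a set \<open>S c\<close>. The sets are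
  assigned to objects only; no functoriality of \<open>S\<close> is required. Requiring the arrows to be induced
  by maps of sets would exclude the functors of cluster structures: already for
  \<open>ex = {a, b}\<close> with \<open>\<beta>(a)(b) = 1\<close>, the composite of one of the two mutation isomorphisms in
  direction \<open>a\<close> with the inverse of the other is the transvection \<open>a \<mapsto> a\<close>, \<open>b \<mapsto> a + b\<close> of
  infinite order, which permutes no basis.
\<close>
definition free_abelian_sheaf :: "('o, 'm) category \<Rightarrow> ('o, 'm, 's \<Rightarrow>\<^sub>0 int) ab_functor \<Rightarrow> bool" where
  "free_abelian_sheaf C F \<longleftrightarrow>
     ab_functor C F \<and> (\<exists>S. \<forall>c\<in>Obj C. fobj F c = free_Abelian_group (S c))"

text \<open>Functions are extensional so that homomorphisms are determined by their values on the group.\<close>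
definition dual_group :: "'x monoid \<Rightarrow> ('x \<Rightarrow> int) monoid" where
  "dual_group G = \<lparr>carrier = hom G integer_group \<inter> extensional (carrier G),
     monoid.mult = (\<lambda>\<phi> \<psi>. restrict (\<lambda>x. \<phi> x + \<psi> x) (carrier G)),
     one = restrict (\<lambda>x. 0) (carrier G)\<rparr>"

text \<open>For a functor on \<open>C\<close> this is a functor on \<open>op_category C\<close>.\<close>
definition dual_functor :: "('o, 'm) category \<Rightarrow> ('o, 'm, 'x) ab_functor \<Rightarrow> ('o, 'm, 'x \<Rightarrow> int) ab_functor" where
  "dual_functor C A = \<lparr>fobj = (\<lambda>c. dual_group (fobj A c)),
     farr = (\<lambda>f \<phi>. restrict (\<lambda>a. \<phi> (farr A f a)) (carrier (fobj A (Dom C f))))\<rparr>"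

section \<open>The signed path category\<close>

datatype sgn = Pos | Neg

fun flip :: "sgn \<Rightarrow> sgn" where
  "flip Pos = Neg" | "flip Neg = Pos"

text \<open>
  \<open>(c, s, d)\<close> is the arrow of sign \<open>s\<close> over the arrow \<open>(c, d)\<close>. Paths are listed in order of traversal.
\<close>
type_synonym 'v sarrow = "'v \<times> sgn \<times> 'v"

inductive spath :: "'v pair_pre_digraph \<Rightarrow> 'v \<Rightarrow> 'v sarrow list \<Rightarrow> 'v \<Rightarrow> bool" for G where
  spath_Nil: "c \<in> pverts G \<Longrightarrow> spath G c [] c"
| spath_Cons: "(c, d) \<in> parcs G \<Longrightarrow> spath G d p e \<Longrightarrow> spath G c ((c, s, d) # p) e"

text \<open>
  The least congruence on paths identifying \<open>\<gamma>\<^sup>- \<circ> \<alpha>\<^sup>+\<close> and \<open>\<gamma>\<^sup>+ \<circ> \<alpha>\<^sup>-\<close> with identities, for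
  \<open>\<alpha> : c \<rightarrow> d\<close> and \<open>\<gamma> : d \<rightarrow> c\<close>.
\<close>
inductive spath_cong :: "'v pair_pre_digraph \<Rightarrow> 'v \<Rightarrow> 'v \<Rightarrow> 'v sarrow list \<Rightarrow> 'v sarrow list \<Rightarrow> bool"
  for G a b where
  cong_refl: "spath G a p b \<Longrightarrow> spath_cong G a b p p"
| cong_sym: "spath_cong G a b p q \<Longrightarrow> spath_cong G a b q p"
| cong_trans: "spath_cong G a b p q \<Longrightarrow> spath_cong G a b q r \<Longrightarrow> spath_cong G a b p r"
| cong_cancel: "spath G a (p @ [(c, s, d), (d, flip s, c)] @ q) b \<Longrightarrow>
    spath_cong G a b (p @ [(c, s, d), (d, flip s, c)] @ q) (p @ q)"

type_synonym 'v smor = "'v \<times> 'v sarrow list set \<times> 'v"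

definition path_class :: "'v pair_pre_digraph \<Rightarrow> 'v \<Rightarrow> 'v sarrow list \<Rightarrow> 'v \<Rightarrow> 'v smor" where
  "path_class G a p b = (a, {q. spath_cong G a b p q}, b)"

definition signed_arrow :: "'v pair_pre_digraph \<Rightarrow> sgn \<Rightarrow> 'v \<Rightarrow> 'v \<Rightarrow> 'v smor" where
  "signed_arrow G s c d = path_class G c [(c, s, d)] d"

definition signed_path_category :: "'v pair_pre_digraph \<Rightarrow> ('v, 'v smor) category" where
  "signed_path_category G = \<lparr>
     Obj = pverts G,
     Arr = {path_class G a p b | a p b. spath G a p b},
     Dom = (\<lambda>(a, m, b). a),
     Cod = (\<lambda>(a, m, b). b),
     Idm = (\<lambda>c. path_class G c [] c),
     Cmp = (\<lambda>(b', n, c) (a, m, b). (a, {r. \<exists>p\<in>m. \<exists>q\<in>n. spath_cong G a c (p @ q) r}, c))\<rparr>"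

section \<open>Abstract quantum cluster structures\<close>

definition factorization_contra_cov ::
  "('o, 'm) category \<Rightarrow> ('o, 'm, 'x) ab_functor \<Rightarrow> ('o, 'm, 'y) ab_functor \<Rightarrow> ('o \<Rightarrow> 'x \<Rightarrow> 'y) \<Rightarrow> bool" where
  "factorization_contra_cov C X A \<beta> \<longleftrightarrow>
     (\<forall>c\<in>Obj C. \<beta> c \<in> hom (fobj X c) (fobj A c)) \<and>
     (\<forall>f\<in>Arr C. \<forall>x\<in>carrier (fobj X (Cod C f)).
        \<beta> (Cod C f) x = farr A f (\<beta> (Dom C f) (farr X f x)))"

definition factorization_cov_contra ::
  "('o, 'm) category \<Rightarrow> ('o, 'm, 'y) ab_functor \<Rightarrow> ('o, 'm, 'x) ab_functor \<Rightarrow> ('o \<Rightarrow> 'y \<Rightarrow> 'x) \<Rightarrow> bool" where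
  "factorization_cov_contra C A X \<rho> \<longleftrightarrow>
     (\<forall>c\<in>Obj C. \<rho> c \<in> hom (fobj A c) (fobj X c)) \<and>
     (\<forall>f\<in>Arr C. \<forall>a\<in>carrier (fobj A (Dom C f)).
        \<rho> (Dom C f) a = farr X f (\<rho> (Cod C f) (farr A f a)))"

definition pairing_map ::
  "('o, 'm, 'y) ab_functor \<Rightarrow> ('o \<Rightarrow> 'y \<Rightarrow> 'x \<Rightarrow> int) \<Rightarrow> 'o \<Rightarrow> 'x \<Rightarrow> 'y \<Rightarrow> int" where
  "pairing_map A P c x = restrict (\<lambda>a. P c a x) (carrier (fobj A c))"

definition right_nondegenerate_pairing ::
  "('o, 'm) category \<Rightarrow> ('o, 'm, 'y) ab_functor \<Rightarrow> ('o, 'm, 'x) ab_functor \<Rightarrow> ('o \<Rightarrow> 'y \<Rightarrow> 'x \<Rightarrow> int) \<Rightarrow> bool" where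
  "right_nondegenerate_pairing C A X P \<longleftrightarrow>
     (\<forall>c\<in>Obj C. \<forall>x\<in>carrier (fobj X c). (\<lambda>a. P c a x) \<in> hom (fobj A c) integer_group) \<and>
     (\<forall>c\<in>Obj C. \<forall>a\<in>carrier (fobj A c). P c a \<in> hom (fobj X c) integer_group) \<and>
     (\<forall>f\<in>Arr C. \<forall>a\<in>carrier (fobj A (Dom C f)). \<forall>x\<in>carrier (fobj X (Cod C f)).
        P (Dom C f) a (farr X f x) = P (Cod C f) (farr A f a) x) \<and>
     (\<forall>c\<in>Obj C. inj_on (pairing_map A P c) (carrier (fobj X c)))"

definition abstract_cluster_structure ::
  "'v pair_pre_digraph \<Rightarrow> ('v, 'v smor) category
    \<Rightarrow> ('v, 'v smor, 's \<Rightarrow>\<^sub>0 int) ab_functor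
    \<Rightarrow> ('v \<Rightarrow> ('s \<Rightarrow>\<^sub>0 int) \<Rightarrow> ('t \<Rightarrow>\<^sub>0 int))
    \<Rightarrow> ('v, 'v smor, 't \<Rightarrow>\<^sub>0 int) ab_functor
    \<Rightarrow> ('v \<Rightarrow> ('t \<Rightarrow>\<^sub>0 int) \<Rightarrow> ('s \<Rightarrow>\<^sub>0 int) \<Rightarrow> int) \<Rightarrow> bool" where
  "abstract_cluster_structure G \<E> X \<beta> A P \<longleftrightarrow>
     pair_loopfree_digraph G \<and>
     \<E> = signed_path_category G \<and>
     free_abelian_sheaf (op_category \<E>) X \<and>
     free_abelian_sheaf \<E> A \<and>
     factorization_contra_cov \<E> X A \<beta> \<and>
     right_nondegenerate_pairing \<E> A X P"

text \<open>
  A retraction of \<open>\<beta>\<close> with values in \<open>A\<^sup>*\<close>: the group \<open>X\<^sub>c\<close> is regarded as a subgroup of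
  \<open>A\<^sub>c\<^sup>*\<close> through the injection \<open>\<delta>\<^sub>c = pairing_map A P c\<close>, so that \<open>\<rho>\<^sub>c \<circ> \<beta>\<^sub>c = id\<close> reads
  \<open>\<rho>\<^sub>c \<circ> \<beta>\<^sub>c = \<delta>\<^sub>c\<close>. Every factorization \<open>\<rho>' : A \<rightarrow> X\<close> with \<open>\<rho>'\<^sub>c \<circ> \<beta>\<^sub>c = id\<close> gives one,
  namely \<open>\<delta> \<circ> \<rho>'\<close>.
\<close>
definition dual_retraction ::
  "('v, 'm) category
    \<Rightarrow> ('v, 'm, 'x) ab_functor
    \<Rightarrow> ('v \<Rightarrow> 'x \<Rightarrow> 'y)
    \<Rightarrow> ('v, 'm, 'y) ab_functor
    \<Rightarrow> ('v \<Rightarrow> 'y \<Rightarrow> 'x \<Rightarrow> int)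
    \<Rightarrow> ('v \<Rightarrow> 'y \<Rightarrow> 'y \<Rightarrow> int) \<Rightarrow> bool" where
  "dual_retraction \<E> X \<beta> A P \<rho> \<longleftrightarrow>
     factorization_cov_contra \<E> A (dual_functor \<E> A) \<rho> \<and>
     (\<forall>c\<in>Obj \<E>. \<forall>x\<in>carrier (fobj X c). \<rho> c (\<beta> c x) = pairing_map A P c x)"

text \<open>
  A quantum structure is a factorization \<open>\<lambda> : A \<rightarrow> A\<^sup>*\<close> whose transpose
  \<open>\<lambda>\<^sup>* : a \<mapsto> (a' \<mapsto> \<lambda>(a')(a))\<close> is such a retraction \<open>\<rho>\<close>.

  Pitfall: the narrower condition ``\<open>\<lambda> = \<delta> \<circ> \<rho>'\<close> for a factorization \<open>\<rho>' : A \<rightarrow> X\<close> with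
  \<open>\<rho>'\<^sub>c \<circ> \<beta>\<^sub>c = id\<close>'' fails for every quantum cluster algebra having an exchangeable element.
  It gives \<open>\<lambda>\<^sub>c \<circ> \<beta>\<^sub>c = \<delta>\<^sub>c\<close>, whereas \<open>\<lambda>\<^sub>c \<circ> \<beta>\<^sub>c = - \<delta>\<^sub>c\<close> by compatibility and skew-symmetry (see
  \<open>form_lambda_beta\<close> below); the compatibility condition \<open>\<lambda>\<^sup>* \<circ> \<beta> = \<delta> \<circ> \<iota>\<close> of the data concerns the
  transpose. Moreover the image of \<open>\<lambda>\<^sub>c\<close>, in the lattice on the whole basis, is in general not
  contained in \<open>\<delta>\<^sub>c(X\<^sub>c)\<close>, the lattice on the exchangeable elements; for \<open>B = {a, b}\<close>, \<open>ex = {a}\<close>,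
  \<open>\<beta>(a) = b\<^sup>*\<close>, \<open>\<lambda>(a\<^sup>*) = b\<close>, \<open>\<lambda>(b\<^sup>*) = - a\<close> no sign convention helps.
\<close>
definition quantum_structure ::
  "('v, 'm) category
    \<Rightarrow> ('v, 'm, 'x) ab_functor
    \<Rightarrow> ('v \<Rightarrow> 'x \<Rightarrow> 'y)
    \<Rightarrow> ('v \<Rightarrow> 'y \<Rightarrow> 'y \<Rightarrow> int)
    \<Rightarrow> ('v, 'm, 'y) ab_functor
    \<Rightarrow> ('v \<Rightarrow> 'y \<Rightarrow> 'x \<Rightarrow> int) \<Rightarrow> bool" where
  "quantum_structure \<E> X \<beta> \<Lambda> A P \<longleftrightarrow>
     factorization_cov_contra \<E> A (dual_functor \<E> A) \<Lambda> \<and>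
     (\<exists>\<rho>. dual_retraction \<E> X \<beta> A P \<rho> \<and>
        (\<forall>c\<in>Obj \<E>. \<forall>a\<in>carrier (fobj A c). \<forall>a'\<in>carrier (fobj A c). \<Lambda> c a' a = \<rho> c a a'))"

definition abstract_quantum_cluster_structure ::
  "'v pair_pre_digraph \<Rightarrow> ('v, 'v smor) category
    \<Rightarrow> ('v, 'v smor, 's \<Rightarrow>\<^sub>0 int) ab_functor
    \<Rightarrow> ('v \<Rightarrow> ('s \<Rightarrow>\<^sub>0 int) \<Rightarrow> ('t \<Rightarrow>\<^sub>0 int))
    \<Rightarrow> ('v \<Rightarrow> ('t \<Rightarrow>\<^sub>0 int) \<Rightarrow> ('t \<Rightarrow>\<^sub>0 int) \<Rightarrow> int)
    \<Rightarrow> ('v, 'v smor, 't \<Rightarrow>\<^sub>0 int) ab_functor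
    \<Rightarrow> ('v \<Rightarrow> ('t \<Rightarrow>\<^sub>0 int) \<Rightarrow> ('s \<Rightarrow>\<^sub>0 int) \<Rightarrow> int) \<Rightarrow> bool" where
  "abstract_quantum_cluster_structure G \<E> X \<beta> \<Lambda> A P \<longleftrightarrow>
     abstract_cluster_structure G \<E> X \<beta> A P \<and> quantum_structure \<E> X \<beta> \<Lambda> A P"

section \<open>Quantum cluster data and mutation\<close>

text \<open>
  An element \<open>\<Sum> v\<^sub>b b\<^sup>*\<close> of the dual lattice, the free abelian group on the dual basis, is stored by
  its coordinates \<open>v\<^sub>b\<close>, so a lattice and its dual lattice are both \<open>free_Abelian_group B\<close>.
  For infinite \<open>B\<close> this is the finitely supported part of the group of all homomorphisms to the integers.
\<close>
definition dual_eval :: "('b \<Rightarrow>\<^sub>0 int) \<Rightarrow> ('b \<Rightarrow>\<^sub>0 int) \<Rightarrow> int" where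
  "dual_eval v w = (\<Sum>b\<in>Poly_Mapping.keys v. Poly_Mapping.lookup v b * Poly_Mapping.lookup w b)"

definition form_beta :: "(('b \<Rightarrow>\<^sub>0 int) \<Rightarrow> ('b \<Rightarrow>\<^sub>0 int)) \<Rightarrow> ('b \<Rightarrow>\<^sub>0 int) \<Rightarrow> ('b \<Rightarrow>\<^sub>0 int) \<Rightarrow> int" where
  "form_beta \<beta> v w = dual_eval (\<beta> v) w"

definition form_lambda :: "(('b \<Rightarrow>\<^sub>0 int) \<Rightarrow> ('b \<Rightarrow>\<^sub>0 int)) \<Rightarrow> ('b \<Rightarrow>\<^sub>0 int) \<Rightarrow> ('b \<Rightarrow>\<^sub>0 int) \<Rightarrow> int" where
  "form_lambda \<Lambda> v w = dual_eval w (\<Lambda> v)"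

definition skew_symmetrizable :: "'b set \<Rightarrow> (('b \<Rightarrow>\<^sub>0 int) \<Rightarrow> ('b \<Rightarrow>\<^sub>0 int)) \<Rightarrow> bool" where
  "skew_symmetrizable ex \<beta> \<longleftrightarrow>
     (\<forall>v\<in>carrier (free_Abelian_group ex). \<forall>w\<in>carrier (free_Abelian_group ex).
        form_beta \<beta> v w = - form_beta \<beta> w v)"

text \<open>\<open>\<Lambda>\<^sup>* = - \<delta> \<circ> \<Lambda>\<close>, evaluated at \<open>w\<close> and then at \<open>v\<close>.\<close>
definition skew_symmetric :: "'b set \<Rightarrow> (('b \<Rightarrow>\<^sub>0 int) \<Rightarrow> ('b \<Rightarrow>\<^sub>0 int)) \<Rightarrow> bool" where
  "skew_symmetric B \<Lambda> \<longleftrightarrow>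
     (\<forall>v\<in>carrier (free_Abelian_group B). \<forall>w\<in>carrier (free_Abelian_group B).
        dual_eval w (\<Lambda> v) = - dual_eval v (\<Lambda> w))"

text \<open>\<open>\<Lambda>\<^sup>* \<circ> \<beta> = \<delta> \<circ> \<iota>\<close>, evaluated at \<open>x\<close> and then at \<open>v\<close>.\<close>
definition compatible :: "'b set \<Rightarrow> 'b set \<Rightarrow> (('b \<Rightarrow>\<^sub>0 int) \<Rightarrow> ('b \<Rightarrow>\<^sub>0 int)) \<Rightarrow> (('b \<Rightarrow>\<^sub>0 int) \<Rightarrow> ('b \<Rightarrow>\<^sub>0 int)) \<Rightarrow> bool" where
  "compatible B ex \<beta> \<Lambda> \<longleftrightarrow>
     (\<forall>x\<in>carrier (free_Abelian_group ex). \<forall>v\<in>carrier (free_Abelian_group B).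
        dual_eval (\<beta> x) (\<Lambda> v) = dual_eval v x)"

text \<open>
  The data defining a quantum cluster algebra; \<open>iv\<close> is the set of invertible frozen elements and
  \<open>qh\<close> is the chosen square root of \<open>q\<close>.
\<close>
locale quantum_cluster_data =
  fixes B ex iv :: "'b set"
    and \<beta> \<Lambda> :: "('b \<Rightarrow>\<^sub>0 int) \<Rightarrow> ('b \<Rightarrow>\<^sub>0 int)"
    and K :: "('k, 'more) ring_scheme"
    and qh :: 'k
  assumes countable_B: "countable B"
    and ex_subset: "ex \<subseteq> B"
    and inv_subset: "iv \<subseteq> B - ex"
    and beta_hom: "\<beta> \<in> hom (free_Abelian_group ex) (free_Abelian_group B)"
    and beta_skew: "skew_symmetrizable ex \<beta>"
    and lambda_hom: "\<Lambda> \<in> hom (free_Abelian_group B) (free_Abelian_group B)"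
    and lambda_skew: "skew_symmetric B \<Lambda>"
    and beta_lambda_compatible: "compatible B ex \<beta> \<Lambda>"
    and field_K: "field K"
    and qh_unit: "qh \<in> Units K"
begin

lemma form_lambda_beta:
  assumes x: "x \<in> carrier (free_Abelian_group ex)" and v: "v \<in> carrier (free_Abelian_group B)"
  shows "form_lambda \<Lambda> (\<beta> x) v = - dual_eval v x"
proof -
  have "\<beta> x \<in> carrier (free_Abelian_group B)"
    using beta_hom x by (rule hom_in_carrier)
  then have "dual_eval v (\<Lambda> (\<beta> x)) = - dual_eval (\<beta> x) (\<Lambda> v)"
    using lambda_skew v unfolding skew_symmetric_def by blast
  then show ?thesis
    using beta_lambda_compatible x v unfolding compatible_def form_lambda_def by simp
qed

end

text \<open>
  \<open>Mu k\<close> is the new symbol replacing \<open>k\<close>. It does not depend on the current basis: a basis reached by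
  mutation contains exactly one symbol \<open>Mu (\<dots> (Mu (Init b)))\<close> for each initial \<open>b\<close>, so \<open>Mu k\<close> is new.
\<close>
datatype 'b symb = Init 'b | Mu "'b symb"

record 'b seed =
  basis :: "'b set"
  exch :: "'b set"
  sbeta :: "('b \<Rightarrow>\<^sub>0 int) \<Rightarrow> ('b \<Rightarrow>\<^sub>0 int)"
  slambda :: "('b \<Rightarrow>\<^sub>0 int) \<Rightarrow> ('b \<Rightarrow>\<^sub>0 int)"

definition relabel :: "('b \<Rightarrow>\<^sub>0 int) \<Rightarrow> ('b symb \<Rightarrow>\<^sub>0 int)" where
  "relabel = frag_extend (\<lambda>b. frag_of (Init b))"

definition unlabel :: "('b symb \<Rightarrow>\<^sub>0 int) \<Rightarrow> ('b \<Rightarrow>\<^sub>0 int)" where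
  "unlabel = frag_extend (\<lambda>s. case s of Init b \<Rightarrow> frag_of b | Mu s' \<Rightarrow> 0)"

text \<open>The given data, with \<open>b\<close> renamed to the symbol \<open>Init b\<close>.\<close>
definition initial_seed ::
  "'b set \<Rightarrow> 'b set \<Rightarrow> (('b \<Rightarrow>\<^sub>0 int) \<Rightarrow> ('b \<Rightarrow>\<^sub>0 int)) \<Rightarrow> (('b \<Rightarrow>\<^sub>0 int) \<Rightarrow> ('b \<Rightarrow>\<^sub>0 int)) \<Rightarrow> 'b symb seed" where
  "initial_seed B ex \<beta> \<Lambda> = \<lparr>basis = Init ` B, exch = Init ` ex,
     sbeta = relabel \<circ> \<beta> \<circ> unlabel, slambda = relabel \<circ> \<Lambda> \<circ> unlabel\<rparr>"

fun part :: "sgn \<Rightarrow> int \<Rightarrow> int" where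
  "part Pos n = max n 0"
| "part Neg n = max (- n) 0"

definition vpart :: "sgn \<Rightarrow> ('b \<Rightarrow>\<^sub>0 int) \<Rightarrow> ('b \<Rightarrow>\<^sub>0 int)" where
  "vpart s = Poly_Mapping.map (part s)"

definition mut_set :: "'b symb \<Rightarrow> 'b symb set \<Rightarrow> 'b symb set" where
  "mut_set k S = (S - {k}) \<union> {Mu k}"

text \<open>The map from the mutated lattice back to the lattice, \<open>\<beta>\<close> being that of the unmutated seed.\<close>
definition mubar :: "sgn \<Rightarrow> 'b symb \<Rightarrow> (('b symb \<Rightarrow>\<^sub>0 int) \<Rightarrow> ('b symb \<Rightarrow>\<^sub>0 int)) \<Rightarrow> ('b symb \<Rightarrow>\<^sub>0 int) \<Rightarrow> ('b symb \<Rightarrow>\<^sub>0 int)" where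
  "mubar s k \<beta> = frag_extend (\<lambda>b. if b = Mu k then - frag_of k
     else frag_of b + frag_cmul (part s (form_beta \<beta> (frag_of k) (frag_of b))) (frag_of k))"

text \<open>The map from the dual lattice to the mutated dual lattice, and its inverse.\<close>
definition mu_dual :: "sgn \<Rightarrow> 'b symb \<Rightarrow> (('b symb \<Rightarrow>\<^sub>0 int) \<Rightarrow> ('b symb \<Rightarrow>\<^sub>0 int)) \<Rightarrow> ('b symb \<Rightarrow>\<^sub>0 int) \<Rightarrow> ('b symb \<Rightarrow>\<^sub>0 int)" where
  "mu_dual s k \<beta> = frag_extend (\<lambda>b. if b = k then vpart s (\<beta> (frag_of k)) - frag_of (Mu k)
     else frag_of b)"

definition mubar_dual :: "sgn \<Rightarrow> 'b symb \<Rightarrow> (('b symb \<Rightarrow>\<^sub>0 int) \<Rightarrow> ('b symb \<Rightarrow>\<^sub>0 int)) \<Rightarrow> ('b symb \<Rightarrow>\<^sub>0 int) \<Rightarrow> ('b symb \<Rightarrow>\<^sub>0 int)" where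
  "mubar_dual s k \<beta> = frag_extend (\<lambda>b. if b = Mu k then vpart s (\<beta> (frag_of k)) - frag_of k
     else frag_of b)"

text \<open>The mutated homomorphisms are the unique ones inducing the pulled back bilinear forms.\<close>
definition mutate :: "'b symb \<Rightarrow> 'b symb seed \<Rightarrow> 'b symb seed" where
  "mutate k \<Sigma> = \<lparr>
     basis = mut_set k (basis \<Sigma>),
     exch = mut_set k (exch \<Sigma>),
     sbeta = (\<lambda>v. THE u. u \<in> carrier (free_Abelian_group (mut_set k (basis \<Sigma>))) \<and>
       (\<forall>w\<in>carrier (free_Abelian_group (mut_set k (basis \<Sigma>))).
          dual_eval u w = form_beta (sbeta \<Sigma>) (mubar Pos k (sbeta \<Sigma>) v) (mubar Pos k (sbeta \<Sigma>) w))),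
     slambda = (\<lambda>v. THE u. u \<in> carrier (free_Abelian_group (mut_set k (basis \<Sigma>))) \<and>
       (\<forall>w\<in>carrier (free_Abelian_group (mut_set k (basis \<Sigma>))).
          dual_eval w u = form_lambda (slambda \<Sigma>) (mubar_dual Pos k (sbeta \<Sigma>) v) (mubar_dual Pos k (sbeta \<Sigma>) w)))\<rparr>"

text \<open>The sequence \<open>(k\<^sub>r, \<dots>, k\<^sub>1)\<close> is the list with head \<open>k\<^sub>r\<close>; mutation at \<open>k\<^sub>1\<close> comes first.\<close>
fun mutate_seq :: "'b symb list \<Rightarrow> 'b symb seed \<Rightarrow> 'b symb seed" where
  "mutate_seq [] \<Sigma> = \<Sigma>"
| "mutate_seq (k # ks) \<Sigma> = mutate k (mutate_seq ks \<Sigma>)"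

fun admissible :: "'b symb seed \<Rightarrow> 'b symb list \<Rightarrow> bool" where
  "admissible \<Sigma> [] \<longleftrightarrow> True"
| "admissible \<Sigma> (k # ks) \<longleftrightarrow> admissible \<Sigma> ks \<and> k \<in> exch (mutate_seq ks \<Sigma>)"

definition exchange_tree :: "'b symb seed \<Rightarrow> 'b symb list pair_pre_digraph" where
  "exchange_tree \<Sigma> = \<lparr>pverts = {ks. admissible \<Sigma> ks},
     parcs = {(ks, k # ks) | k ks. admissible \<Sigma> (k # ks)}\<rparr>"

end

theory Submission
  imports Defs
begin

text \<open>
  The relations of a signed path category live over 2-cycles, and the exchange tree has none; so a
  morphism of its signed path category is a single path, and functoriality and all naturality conditions
  reduce to one mutation.

  For one mutation at \<open>k\<close> in either sign, \<open>mubar\<close> on the lattice is adjoint to \<open>mu_dual\<close> on the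
  dual lattice. The defining property of the mutated \<open>\<beta>\<close> is therefore the factorization
  \<open>\<beta>' = mu_dual \<circ> \<beta> \<circ> mubar\<close> for the sign \<open>+\<close>. The two maps \<open>mubar\<close> differ by
  \<open>v \<mapsto> \<langle>k, v\<rangle> k\<close>, and skew-symmetry makes the resulting correction terms of the form cancel, which
  gives the sign \<open>-\<close>. For \<open>\<Lambda>\<close>, applying \<open>mu_dual\<close> and then the \<open>+\<close> version of \<open>mubar_dual\<close> is the
  identity for the sign \<open>+\<close> and \<open>v \<mapsto> v - v\<^sub>k \<beta>(k)\<close> for the sign \<open>-\<close>; by compatibility and
  skew-symmetry the latter is an isometry for \<open>\<Lambda>\<close>. The retraction in the quantum structure is the
  transpose of \<open>\<Lambda>\<close>, and compatibility, which persists under mutation, is the retraction property.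
\<close>

abbreviation (input) keys where "keys \<equiv> Poly_Mapping.keys"
abbreviation (input) lookup where "lookup \<equiv> Poly_Mapping.lookup"

section \<open>The evaluation form\<close>

text \<open>The definition sums over the support of the first argument only. Enlarging the index set
  to a common finite set makes the expression symmetric.\<close>

lemma dual_eval_eq_sum:
  assumes "finite S" "keys v \<subseteq> S"
  shows "dual_eval v w = (\<Sum>b\<in>S. lookup v b * lookup w b)"
  unfolding dual_eval_def
  by (rule sum.mono_neutral_left) (use assms in \<open>auto simp: in_keys_iff\<close>)

lemma dual_eval_commute: "dual_eval v w = dual_eval w v"
  by (subst (1 2) dual_eval_eq_sum[of "keys v \<union> keys w"]) (auto simp: mult.commute)

lemma dual_eval_add_right [simp]: "dual_eval v (w + w') = dual_eval v w + dual_eval v w'"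
  by (simp add: dual_eval_def lookup_add algebra_simps sum.distrib)

lemma dual_eval_uminus_right [simp]: "dual_eval v (- w) = - dual_eval v w"
  by (simp add: dual_eval_def sum_negf)

lemma dual_eval_diff_right [simp]: "dual_eval v (w - w') = dual_eval v w - dual_eval v w'"
  by (simp add: dual_eval_def lookup_minus algebra_simps sum_subtractf)

lemma dual_eval_cmul_right [simp]: "dual_eval v (frag_cmul n w) = n * dual_eval v w"
  by (simp add: dual_eval_def sum_distrib_left algebra_simps)

lemma dual_eval_of_left [simp]: "dual_eval (frag_of b) w = lookup w b"
  by (simp add: dual_eval_def)

lemma dual_eval_left [simp]:
  "dual_eval (v + v') w = dual_eval v w + dual_eval v' w"
  "dual_eval (- v) w = - dual_eval v w"
  "dual_eval (v - v') w = dual_eval v w - dual_eval v' w"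
  "dual_eval (frag_cmul n v) w = n * dual_eval v w"
  by (simp_all add: dual_eval_commute[of _ w])

lemma dual_eval_of_right [simp]: "dual_eval v (frag_of b) = lookup v b"
  by (simp add: dual_eval_commute[of v])

lemma dual_eval_0_right [simp]: "dual_eval v 0 = 0"
  by (simp add: dual_eval_def)

text \<open>Coordinates outside \<open>S\<close> vanish on both sides. This is the non-degeneracy
  behind the uniqueness of the mutated homomorphisms and behind the injectivity of the pairing
  maps.\<close>

lemma dual_eval_eqI:
  assumes "keys u \<subseteq> S" "keys u' \<subseteq> S"
    and "\<And>b. b \<in> S \<Longrightarrow> dual_eval u (frag_of b) = dual_eval u' (frag_of b)"
  shows "u = u'"
proof (rule poly_mapping_eqI)
  fix b show "lookup u b = lookup u' b"
  proof (cases "b \<in> S")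
    case True
    then show ?thesis using assms(3) by simp
  next
    case False
    then have "b \<notin> keys u" "b \<notin> keys u'" using assms(1,2) by blast+
    then show ?thesis by (simp add: in_keys_iff)
  qed
qed

lemma additive_eqI:
  assumes "keys v \<subseteq> S"
    and "\<And>v w. keys v \<subseteq> S \<Longrightarrow> keys w \<subseteq> S \<Longrightarrow> f (v - w) = f v - f w"
    and "\<And>v w. keys v \<subseteq> S \<Longrightarrow> keys w \<subseteq> S \<Longrightarrow> g (v - w) = g v - g w"
    and "\<And>b. b \<in> S \<Longrightarrow> f (frag_of b) = g (frag_of b)"
  shows "f v = (g v :: 'c :: ab_group_add)"
  using assms(1)
proof (rule free_Abelian_group_induct)
  \<comment> \<open>Compatibility with differences already forces the value at 0, since
    \<open>f (0 - 0) = f 0 - f 0\<close>.\<close>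
  show "f 0 = g 0"
    using assms(2)[of 0 0] assms(3)[of 0 0] by simp
qed (simp_all add: assms)

text \<open>The hypothesis says that the matrices of \<open>F\<close> and \<open>G\<close> are
  transposes of each other. By biadditivity it is enough to compare entries, first varying
  \<open>w\<close> against a generator, then varying \<open>u\<close>.\<close>

lemma frag_extend_adjoint:
  assumes "keys u \<subseteq> S" "keys w \<subseteq> T"
    and "\<And>b c. b \<in> S \<Longrightarrow> c \<in> T \<Longrightarrow> lookup (F b) c = lookup (G c) b"
  shows "dual_eval (frag_extend F u) w = dual_eval u (frag_extend G w)"
proof -
  let ?L = "\<lambda>u w. dual_eval (frag_extend F u) w" and ?R = "\<lambda>u w. dual_eval u (frag_extend G w)"
  have "?L (frag_of b) w = ?R (frag_of b) w" if "b \<in> S" for b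
    using assms(2)
    by (rule additive_eqI[where f = "?L (frag_of b)" and g = "?R (frag_of b)"])
      (use assms(3) that in \<open>simp_all add: frag_extend_diff lookup_minus\<close>)
  then show ?thesis
    by (intro additive_eqI[where f = "\<lambda>u. ?L u w" and g = "\<lambda>u. ?R u w", OF assms(1)])
      (simp_all add: frag_extend_diff)
qed

section \<open>Supports of combinations and images\<close>

lemma keys_add_subset: "keys v \<subseteq> S \<Longrightarrow> keys w \<subseteq> S \<Longrightarrow> keys (v + w) \<subseteq> S"
  using keys_add[of v w] by blast

lemma keys_diff_subset: "keys v \<subseteq> S \<Longrightarrow> keys w \<subseteq> S \<Longrightarrow> keys (v - w) \<subseteq> S"
  using keys_diff[of v w] by blast

lemma keys_cmul_subset: "keys v \<subseteq> S \<Longrightarrow> keys (frag_cmul n v) \<subseteq> S"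
  using keys_cmul[of n v] by blast

lemma keys_frag_extend_subset:
  assumes "keys v \<subseteq> S" "\<And>b. b \<in> S \<Longrightarrow> keys (F b) \<subseteq> T"
  shows "keys (frag_extend F v) \<subseteq> T"
  using keys_frag_extend[of F v] assms by blast

lemma frag_extend_id:
  assumes "\<And>b. b \<in> keys v \<Longrightarrow> F b = frag_of b"
  shows "frag_extend F v = v"
  using frag_extend_eq[of v F frag_of] assms by (simp flip: frag_expansion)

text \<open>\<open>Poly_Mapping.map\<close> yields 0 off the support, which agrees with
  \<open>part s\<close> because both parts of 0 are 0.\<close>

lemma lookup_vpart [simp]: "lookup (vpart s v) b = part s (lookup v b)"
  by (cases s) (simp_all add: vpart_def map.rep_eq when_def)

lemma keys_vpart_subset: "keys v \<subseteq> S \<Longrightarrow> keys (vpart s v) \<subseteq> S"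
  by (cases s) (auto simp: in_keys_iff)

lemma vpart_diff: "vpart Pos v - vpart Neg v = v"
  by (rule poly_mapping_eqI) (simp add: lookup_minus)

section \<open>Functors on the signed path category of a digraph without 2-cycles\<close>

text \<open>Without 2-cycles no cancellation applies, so a morphism is a single path.\<close>

lemma spath_append_arcsD:
  "spath G a (p @ [(c, s, d), (d, t, c')] @ q) b \<Longrightarrow> (c, d) \<in> parcs G \<and> (d, c') \<in> parcs G"
proof (induction p arbitrary: a)
  case Nil
  then have "spath G a ((c, s, d) # (d, t, c') # q) b" by simp
  then have arc: "(c, d) \<in> parcs G" "spath G d ((d, t, c') # q) b" by (cases; simp)+
  from arc(2) have "(d, c') \<in> parcs G" by (cases; simp)
  with arc(1) show ?case by simp
next
  case (Cons x p)
  from Cons.prems show ?case by cases (use Cons.IH in auto)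
qed

lemma spath_append: "spath G a p b \<Longrightarrow> spath G b q c \<Longrightarrow> spath G a (p @ q) c"
  by (induction rule: spath.induct) (auto intro: spath_Cons)

text \<open>The set in a morphism will be a singleton, so \<open>the_elem\<close> recovers its path.
  Paths are listed in order of traversal: \<open>fold\<close> applies the first arrow first, and the
  contravariant version below uses \<open>foldr\<close>.\<close>

definition cov_functor ::
  "('v \<Rightarrow> 'x monoid) \<Rightarrow> ('v sarrow \<Rightarrow> 'x \<Rightarrow> 'x) \<Rightarrow> ('v, 'v smor, 'x) ab_functor" where
  "cov_functor F m = \<lparr>fobj = F, farr = (\<lambda>(a, ps, b). fold m (the_elem ps))\<rparr>"

definition contra_functor ::
  "('v \<Rightarrow> 'x monoid) \<Rightarrow> ('v sarrow \<Rightarrow> 'x \<Rightarrow> 'x) \<Rightarrow> ('v, 'v smor, 'x) ab_functor" where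
  "contra_functor F m = \<lparr>fobj = F, farr = (\<lambda>(a, ps, b). foldr m (the_elem ps))\<rparr>"

lemma fobj_functor [simp]: "fobj (cov_functor F m) = F" "fobj (contra_functor F m) = F"
  by (simp_all add: cov_functor_def contra_functor_def)

lemma farr_functor [simp]:
  "farr (cov_functor F m) (a, {p}, b) = fold m p"
  "farr (contra_functor F m) (a, {p}, b) = foldr m p"
  by (simp_all add: cov_functor_def contra_functor_def)

lemma signed_path_category_simps [simp]:
  "Obj (signed_path_category G) = pverts G"
  "Dom (signed_path_category G) (a, m, b) = a"
  "Cod (signed_path_category G) (a, m, b) = b"
  "Idm (signed_path_category G) c = path_class G c [] c"
  by (simp_all add: signed_path_category_def)

lemma op_category_simps [simp]:
  "Obj (op_category C) = Obj C" "Arr (op_category C) = Arr C"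
  "Dom (op_category C) = Cod C" "Cod (op_category C) = Dom C"
  "Idm (op_category C) = Idm C" "Cmp (op_category C) g f = Cmp C f g"
  by (simp_all add: op_category_def)

locale no_2_cycle_digraph = pair_wf_digraph G for G :: "'v pair_pre_digraph" +
  assumes no_2_cycle: "(c, d) \<in> parcs G \<Longrightarrow> (d, c) \<notin> parcs G"
begin

text \<open>Only \<open>cong_cancel\<close> could relate distinct paths, and its premise contains an
  arrow followed by its reverse.\<close>

lemma spath_cong_eq: "spath_cong G a b p q \<Longrightarrow> p = q"
  by (induction rule: spath_cong.induct) (use spath_append_arcsD no_2_cycle in fastforce)+

lemma path_class_eq: "spath G a p b \<Longrightarrow> path_class G a p b = (a, {p}, b)"
  unfolding path_class_def by (auto dest: spath_cong_eq intro: cong_refl)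

lemma spath_verts: "spath G a p b \<Longrightarrow> a \<in> pverts G \<and> b \<in> pverts G"
  by (induction rule: spath.induct) (auto dest: in_arcsD1)

lemma signed_arrow_eq: "(c, d) \<in> parcs G \<Longrightarrow> signed_arrow G s c d = (c, {[(c, s, d)]}, d)"
  unfolding signed_arrow_def
  by (rule path_class_eq) (auto intro: spath_Cons spath_Nil dest: in_arcsD2)

lemma Arr_signed_path_category:
  "Arr (signed_path_category G) = {(a, {p}, b) | a p b. spath G a p b}"
  unfolding signed_path_category_def by (force simp: path_class_eq)

lemma Cmp_signed_path_category:
  assumes "spath G a p b" "spath G b q c"
  shows "Cmp (signed_path_category G) (b, {q}, c) (a, {p}, b) = (a, {p @ q}, c)"
  unfolding signed_path_category_def
  using spath_append[OF assms] by (auto dest: spath_cong_eq intro: cong_refl)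

section \<open>From single arrows to paths\<close>

lemma fold_hom:
  assumes "\<And>c s d. (c, d) \<in> parcs G \<Longrightarrow> m (c, s, d) \<in> hom (F c) (F d)" "spath G a p b"
  shows "fold m p \<in> hom (F a) (F b)"
  using assms(2)
proof (induction rule: spath.induct)
  case (spath_Nil c)
  then show ?case by (auto simp: hom_def)
next
  case (spath_Cons c d p e s)
  then show ?case
    using hom_compose[OF assms(1)[OF spath_Cons.hyps(1), of s] spath_Cons.IH] by (simp add: comp_def)
qed

lemma foldr_hom:
  assumes "\<And>c s d. (c, d) \<in> parcs G \<Longrightarrow> m (c, s, d) \<in> hom (F d) (F c)" "spath G a p b"
  shows "foldr m p \<in> hom (F b) (F a)"
  using assms(2)
proof (induction rule: spath.induct)
  case (spath_Nil c)
  then show ?case by (auto simp: hom_def)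
next
  case (spath_Cons c d p e s)
  then show ?case
    using hom_compose[OF spath_Cons.IH assms(1)[OF spath_Cons.hyps(1), of s]] by (simp add: comp_def)
qed

lemma ab_functor_cov_functor:
  assumes "\<And>c. c \<in> pverts G \<Longrightarrow> comm_group (F c)"
    and "\<And>c s d. (c, d) \<in> parcs G \<Longrightarrow> m (c, s, d) \<in> hom (F c) (F d)"
  shows "ab_functor (signed_path_category G) (cov_functor F m)"
  unfolding ab_functor_def Arr_signed_path_category
  using assms(1) fold_hom[where m = m and F = F, OF assms(2)]
  by (auto simp: Cmp_signed_path_category path_class_eq spath_Nil)

lemma ab_functor_contra_functor:
  assumes "\<And>c. c \<in> pverts G \<Longrightarrow> comm_group (F c)"
    and "\<And>c s d. (c, d) \<in> parcs G \<Longrightarrow> m (c, s, d) \<in> hom (F d) (F c)"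
  shows "ab_functor (op_category (signed_path_category G)) (contra_functor F m)"
  unfolding ab_functor_def op_category_simps Arr_signed_path_category
  using assms(1) foldr_hom[where m = m and F = F, OF assms(2)]
  by (auto simp: Cmp_signed_path_category path_class_eq spath_Nil)

text \<open>Induction on the path: the remaining arrows are handled by the induction hypothesis, and
  \<open>step\<close> is applied to the first arrow at the element obtained by pulling
  \<open>x\<close> back along the rest.\<close>

lemma factorization_contra_cov_functors:
  assumes X: "\<And>c s d. (c, d) \<in> parcs G \<Longrightarrow> mX (c, s, d) \<in> hom (X d) (X c)"
    and \<beta>: "\<And>c. c \<in> pverts G \<Longrightarrow> \<beta> c \<in> hom (X c) (A c)"
    and step: "\<And>c s d x. (c, d) \<in> parcs G \<Longrightarrow> x \<in> carrier (X d) \<Longrightarrow>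
      \<beta> d x = mA (c, s, d) (\<beta> c (mX (c, s, d) x))"
  shows "factorization_contra_cov (signed_path_category G)
    (contra_functor X mX) (cov_functor A mA) \<beta>"
proof -
  have "\<beta> b x = fold mA p (\<beta> a (foldr mX p x))" if "spath G a p b" "x \<in> carrier (X b)" for a p b x
    using that
  proof (induction rule: spath.induct)
    case (spath_Cons c d p e s)
    have "foldr mX p x \<in> carrier (X d)"
      using foldr_hom[where m = mX and F = X, OF X spath_Cons.hyps(2)] spath_Cons.prems by (auto simp: hom_def)
    then show ?case
      using spath_Cons step[OF spath_Cons.hyps(1)] by simp
  qed simp
  then show ?thesis
    unfolding factorization_contra_cov_def Arr_signed_path_category using \<beta> by auto
qed

text \<open>Read as a condition on bilinear forms, a factorization into the dual says that each
  arrow is an isometry. In this form, with both arguments moved at once, the condition composes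
  along a path.\<close>

lemma factorization_cov_dual_functor:
  assumes A: "\<And>c s d. (c, d) \<in> parcs G \<Longrightarrow> mA (c, s, d) \<in> hom (A c) (A d)"
    and \<rho>: "\<And>c. c \<in> pverts G \<Longrightarrow> \<rho> c \<in> hom (A c) (dual_group (A c))"
    and step: "\<And>c s d a a'. (c, d) \<in> parcs G \<Longrightarrow> a \<in> carrier (A c) \<Longrightarrow> a' \<in> carrier (A c) \<Longrightarrow>
      \<rho> c a a' = \<rho> d (mA (c, s, d) a) (mA (c, s, d) a')"
  shows "factorization_cov_contra (signed_path_category G)
    (cov_functor A mA) (dual_functor (signed_path_category G) (cov_functor A mA)) \<rho>"
proof -
  have *: "\<rho> a v w = \<rho> b (fold mA p v) (fold mA p w)"
    if "spath G a p b" "v \<in> carrier (A a)" "w \<in> carrier (A a)" for a p b v w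
    using that
  proof (induction arbitrary: v w rule: spath.induct)
    case (spath_Cons c d p e s)
    have "mA (c, s, d) v \<in> carrier (A d)" "mA (c, s, d) w \<in> carrier (A d)"
      using A[OF spath_Cons.hyps(1)] spath_Cons.prems by (auto simp: hom_def)
    then show ?case
      using spath_Cons.IH step[OF spath_Cons.hyps(1) spath_Cons.prems, of s] by simp
  qed simp
  \<comment> \<open>Elements of \<open>dual_group\<close> are extensional, so agreement of values on
    the carrier is equality of functionals.\<close>
  have "\<rho> a v = restrict (\<lambda>w. \<rho> b (fold mA p v) (fold mA p w)) (carrier (A a))"
    if "spath G a p b" "v \<in> carrier (A a)" for a p b v
  proof (rule extensionalityI)
    show "\<rho> a v \<in> extensional (carrier (A a))"
      using \<rho>[of a] spath_verts[OF that(1)] that(2)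
      by (auto simp: hom_def dual_group_def)
  qed (use * that in auto)
  then show ?thesis
    unfolding factorization_cov_contra_def Arr_signed_path_category
    using \<rho> by (auto simp: dual_functor_def)
qed

lemma right_nondegenerate_pairing_functors:
  assumes A: "\<And>c s d. (c, d) \<in> parcs G \<Longrightarrow> mA (c, s, d) \<in> hom (A c) (A d)"
    and X: "\<And>c s d. (c, d) \<in> parcs G \<Longrightarrow> mX (c, s, d) \<in> hom (X d) (X c)"
    and "\<And>c x. c \<in> pverts G \<Longrightarrow> x \<in> carrier (X c) \<Longrightarrow> (\<lambda>a. P c a x) \<in> hom (A c) integer_group"
    and "\<And>c a. c \<in> pverts G \<Longrightarrow> a \<in> carrier (A c) \<Longrightarrow> P c a \<in> hom (X c) integer_group"
    and step: "\<And>c s d a x. (c, d) \<in> parcs G \<Longrightarrow> a \<in> carrier (A c) \<Longrightarrow> x \<in> carrier (X d) \<Longrightarrow>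
      P c a (mX (c, s, d) x) = P d (mA (c, s, d) a) x"
    and "\<And>c. c \<in> pverts G \<Longrightarrow> inj_on (pairing_map (cov_functor A mA) P c) (carrier (X c))"
  shows "right_nondegenerate_pairing (signed_path_category G)
    (cov_functor A mA) (contra_functor X mX) P"
proof -
  have "P a v (foldr mX p x) = P b (fold mA p v) x"
    if "spath G a p b" "v \<in> carrier (A a)" "x \<in> carrier (X b)" for a p b v x
    using that
  proof (induction arbitrary: v rule: spath.induct)
    case (spath_Cons c d p e s)
    have "mA (c, s, d) v \<in> carrier (A d)"
      using A[OF spath_Cons.hyps(1)] spath_Cons.prems by (auto simp: hom_def)
    moreover have "foldr mX p x \<in> carrier (X d)"
      using foldr_hom[where m = mX and F = X, OF X spath_Cons.hyps(2)] spath_Cons.prems by (auto simp: hom_def)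
    ultimately show ?case
      using spath_Cons.IH spath_Cons.prems step[OF spath_Cons.hyps(1)] by simp
  qed simp
  then show ?thesis
    unfolding right_nondegenerate_pairing_def Arr_signed_path_category using assms by auto
qed

end

section \<open>Mutation of seeds\<close>

text \<open>The initial element from which a symbol descends. Mutation keeps it, so it can serve in
  an invariant of seeds.\<close>

primrec origin :: "'b symb \<Rightarrow> 'b" where
  "origin (Init b) = b"
| "origin (Mu s) = origin s"

lemma Mu_neq [simp]: "Mu s \<noteq> s" "s \<noteq> Mu s"
  by (induction s) auto

text \<open>The decomposition of an integer into its positive and negative parts, in the form that
  compares the two signs of \<open>mubar\<close>.\<close>

lemma max_uminus_add: "max (- n) 0 + n = max n (0::int)"
  by simp

lemma part_0 [simp]: "part s 0 = 0"
  by (cases s) simp_all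

lemma mem_mut_set: "b \<in> mut_set k S \<longleftrightarrow> b = Mu k \<or> b \<in> S \<and> b \<noteq> k"
  by (auto simp: mut_set_def)

lemma free_Abelian_group_homI:
  assumes "\<And>x. keys x \<subseteq> S \<Longrightarrow> keys (f x) \<subseteq> T"
    and "\<And>x y. keys x \<subseteq> S \<Longrightarrow> keys y \<subseteq> S \<Longrightarrow> f (x + y) = f x + f y"
  shows "f \<in> hom (free_Abelian_group S) (free_Abelian_group T)"
  using assms by (auto simp: hom_def)

lemma hom_keys:
  "f \<in> hom (free_Abelian_group S) (free_Abelian_group T) \<Longrightarrow> keys x \<subseteq> S \<Longrightarrow> keys (f x) \<subseteq> T"
  using hom_in_carrier[of f "free_Abelian_group S" "free_Abelian_group T" x] by simp

lemma hom_frag_cmul: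
  assumes "f \<in> hom (free_Abelian_group S) (free_Abelian_group T)" "keys x \<subseteq> S"
  shows "f (frag_cmul n x) = frag_cmul n (f x)"
  using hom_int_pow[OF assms(1), of x n] hom_keys[OF assms] assms(2) by simp

text \<open>This evaluates the definite descriptions in \<open>mutate\<close>: any explicit
  functional with the right values is the one described, as testing on generators determines
  it.\<close>

lemma the_dual_eval_eq:
  assumes "keys u \<subseteq> S" "\<And>w. keys w \<subseteq> S \<Longrightarrow> dual_eval u w = f w"
  shows "(THE u. u \<in> carrier (free_Abelian_group S) \<and>
    (\<forall>w\<in>carrier (free_Abelian_group S). dual_eval u w = f w)) = u"
proof (rule the_equality)
  show "u \<in> carrier (free_Abelian_group S) \<and>
      (\<forall>w\<in>carrier (free_Abelian_group S). dual_eval u w = f w)"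
    using assms by simp
  fix u' assume u': "u' \<in> carrier (free_Abelian_group S) \<and>
      (\<forall>w\<in>carrier (free_Abelian_group S). dual_eval u' w = f w)"
  show "u' = u"
  proof (rule dual_eval_eqI)
    fix b assume "b \<in> S"
    then show "dual_eval u' (frag_of b) = dual_eval u (frag_of b)"
      using u' assms(2)[of "frag_of b"] by (simp del: dual_eval_of_right)
  qed (use u' assms(1) in simp_all)
qed

text \<open>The forward mutation isomorphism on the lattice itself. It is the transpose of
  \<open>mubar_dual\<close> and is needed for a closed formula for the mutated \<Lambda>.\<close>

definition mu :: "sgn \<Rightarrow> 'b symb \<Rightarrow> (('b symb \<Rightarrow>\<^sub>0 int) \<Rightarrow> ('b symb \<Rightarrow>\<^sub>0 int)) \<Rightarrow> ('b symb \<Rightarrow>\<^sub>0 int) \<Rightarrow> ('b symb \<Rightarrow>\<^sub>0 int)" where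
  "mu s k \<beta> = frag_extend (\<lambda>b. if b = k then - frag_of (Mu k)
     else frag_of b + frag_cmul (part s (form_beta \<beta> (frag_of k) (frag_of b))) (frag_of (Mu k)))"

lemma mut_maps_add:
  "mu s k \<beta> (v + w) = mu s k \<beta> v + mu s k \<beta> w"
  "mubar s k \<beta> (v + w) = mubar s k \<beta> v + mubar s k \<beta> w"
  "mu_dual s k \<beta> (v + w) = mu_dual s k \<beta> v + mu_dual s k \<beta> w"
  "mubar_dual s k \<beta> (v + w) = mubar_dual s k \<beta> v + mubar_dual s k \<beta> w"
  by (simp_all add: mu_def mubar_def mu_dual_def mubar_dual_def frag_extend_add)

lemma mut_maps_diff:
  "mu s k \<beta> (v - w) = mu s k \<beta> v - mu s k \<beta> w"
  "mubar s k \<beta> (v - w) = mubar s k \<beta> v - mubar s k \<beta> w"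
  "mu_dual s k \<beta> (v - w) = mu_dual s k \<beta> v - mu_dual s k \<beta> w"
  "mubar_dual s k \<beta> (v - w) = mubar_dual s k \<beta> v - mubar_dual s k \<beta> w"
  by (simp_all add: mu_def mubar_def mu_dual_def mubar_dual_def frag_extend_diff)

lemma keys_if_subset:
  "(P \<Longrightarrow> keys v \<subseteq> S) \<Longrightarrow> (\<not> P \<Longrightarrow> keys w \<subseteq> S) \<Longrightarrow> keys (if P then v else w) \<subseteq> S"
  by simp

lemma mubar_keys:
  assumes "k \<in> S" "keys v \<subseteq> mut_set k S"
  shows "keys (mubar s k \<beta> v) \<subseteq> S"
  unfolding mubar_def
  by (rule keys_frag_extend_subset[OF assms(2)])
    (intro keys_if_subset keys_add_subset keys_cmul_subset; use assms(1) in \<open>auto simp: mem_mut_set\<close>)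

lemma dual_group_homI:
  assumes "\<And>v. v \<in> carrier G \<Longrightarrow> f v \<in> hom G integer_group"
    and "\<And>v w x. v \<in> carrier G \<Longrightarrow> w \<in> carrier G \<Longrightarrow> x \<in> carrier G \<Longrightarrow>
      f (v \<otimes>\<^bsub>G\<^esub> w) x = f v x + f w x"
    and "group G"
  shows "(\<lambda>v. restrict (f v) (carrier G)) \<in> hom G (dual_group G)"
proof (rule homI)
  interpret group G by fact
  fix v assume v: "v \<in> carrier G"
  show "restrict (f v) (carrier G) \<in> carrier (dual_group G)"
    using assms(1)[OF v] by (simp add: dual_group_def hom_def)
  fix w assume "w \<in> carrier G"
  with v assms(2) show "restrict (f (v \<otimes>\<^bsub>G\<^esub> w)) (carrier G) =
      restrict (f v) (carrier G) \<otimes>\<^bsub>dual_group G\<^esub> restrict (f w) (carrier G)"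
    by (auto simp: dual_group_def restrict_def fun_eq_iff)
qed

text \<open>Injectivity of \<open>origin\<close> on the basis is what makes every symbol \<open>Mu k\<close> new.\<close>

locale quantum_seed =
  fixes \<Sigma> :: "'b symb seed"
  assumes exch_subset: "exch \<Sigma> \<subseteq> basis \<Sigma>"
    and inj_origin: "inj_on origin (basis \<Sigma>)"
    and sbeta_hom: "sbeta \<Sigma> \<in> hom (free_Abelian_group (exch \<Sigma>)) (free_Abelian_group (basis \<Sigma>))"
    and skew_sbeta: "skew_symmetrizable (exch \<Sigma>) (sbeta \<Sigma>)"
    and slambda_hom: "slambda \<Sigma> \<in> hom (free_Abelian_group (basis \<Sigma>)) (free_Abelian_group (basis \<Sigma>))"
    and skew_slambda: "skew_symmetric (basis \<Sigma>) (slambda \<Sigma>)"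
    and compat: "compatible (basis \<Sigma>) (exch \<Sigma>) (sbeta \<Sigma>) (slambda \<Sigma>)"
begin

abbreviation "\<beta> \<equiv> sbeta \<Sigma>"
abbreviation "\<Lambda> \<equiv> slambda \<Sigma>"

lemma beta_keys: "keys v \<subseteq> exch \<Sigma> \<Longrightarrow> keys (\<beta> v) \<subseteq> basis \<Sigma>"
  using hom_keys[OF sbeta_hom] .

lemma lambda_keys: "keys v \<subseteq> basis \<Sigma> \<Longrightarrow> keys (\<Lambda> v) \<subseteq> basis \<Sigma>"
  using hom_keys[OF slambda_hom] .

lemmas beta_add = hom_frag_add[OF sbeta_hom]
lemmas lambda_add = hom_frag_add[OF slambda_hom]

lemma beta_skew:
  "keys v \<subseteq> exch \<Sigma> \<Longrightarrow> keys w \<subseteq> exch \<Sigma> \<Longrightarrow> dual_eval (\<beta> v) w = - dual_eval (\<beta> w) v"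
  using skew_sbeta unfolding skew_symmetrizable_def form_beta_def
  by (meson carrier_free_Abelian_group_iff)

lemma lambda_skew:
  "keys v \<subseteq> basis \<Sigma> \<Longrightarrow> keys w \<subseteq> basis \<Sigma> \<Longrightarrow> dual_eval w (\<Lambda> v) = - dual_eval v (\<Lambda> w)"
  using skew_slambda unfolding skew_symmetric_def
  by (meson carrier_free_Abelian_group_iff)

lemma beta_lambda:
  "keys x \<subseteq> exch \<Sigma> \<Longrightarrow> keys v \<subseteq> basis \<Sigma> \<Longrightarrow> dual_eval (\<beta> x) (\<Lambda> v) = dual_eval v x"
  using compat unfolding compatible_def by simp

lemma lambda_hom_dual_group:
  "(\<lambda>v. restrict (\<lambda>w. dual_eval w (\<Lambda> v)) (carrier (free_Abelian_group (basis \<Sigma>))))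
    \<in> hom (free_Abelian_group (basis \<Sigma>)) (dual_group (free_Abelian_group (basis \<Sigma>)))"
  by (rule dual_group_homI) (auto simp: hom_def lambda_add)

lemma lambda_transpose_hom_dual_group:
  "(\<lambda>v. restrict (\<lambda>w. dual_eval v (\<Lambda> w)) (carrier (free_Abelian_group (basis \<Sigma>))))
    \<in> hom (free_Abelian_group (basis \<Sigma>)) (dual_group (free_Abelian_group (basis \<Sigma>)))"
  by (rule dual_group_homI) (auto simp: hom_def lambda_add)

end

locale seed_mutation = quantum_seed +
  fixes k
  assumes k_exch: "k \<in> exch \<Sigma>"
begin

abbreviation "B' \<equiv> mut_set k (basis \<Sigma>)"
abbreviation "ex' \<equiv> mut_set k (exch \<Sigma>)"
abbreviation "\<beta>k \<equiv> \<beta> (frag_of k)"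

lemma k_basis: "k \<in> basis \<Sigma>"
  using k_exch exch_subset by blast

text \<open>\<open>Mu k\<close> and \<open>k\<close> are distinct with the same origin, so a basis
  on which \<open>origin\<close> is injective cannot contain both.\<close>

lemma Mu_notin: "Mu k \<notin> basis \<Sigma>"
  using inj_onD[OF inj_origin, of "Mu k" k] k_basis by auto

lemma ex'_subset: "ex' \<subseteq> B'"
  using exch_subset by (auto simp: mem_mut_set)

lemma betak_keys: "keys \<beta>k \<subseteq> basis \<Sigma>"
  by (rule beta_keys) (simp add: k_exch)

text \<open>Skew-symmetry makes this integer equal to its own negative. Hence
  \<open>vpart s \<beta>k\<close> does not involve \<open>k\<close>, and \<open>mu_dual\<close>
  fixes it.\<close>

lemma betak_k [simp]: "lookup \<beta>k k = 0"
  using beta_skew[of "frag_of k" "frag_of k"] k_exch by simp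

lemma betak_Mu [simp]: "lookup \<beta>k (Mu k) = 0"
  using betak_keys Mu_notin by (auto simp: in_keys_iff)

lemma vpart_betak_keys: "keys (vpart s \<beta>k) \<subseteq> basis \<Sigma> - {k}"
  using keys_vpart_subset[OF betak_keys] by (auto simp: in_keys_iff)

section \<open>Supports and adjointness of the mutation maps\<close>

lemma mu_keys: "keys v \<subseteq> basis \<Sigma> \<Longrightarrow> keys (mu s k \<beta> v) \<subseteq> B'"
  unfolding mu_def
  by (erule keys_frag_extend_subset)
    (intro keys_if_subset keys_add_subset keys_cmul_subset; auto simp: mem_mut_set)

lemma mu_dual_keys: "keys v \<subseteq> basis \<Sigma> \<Longrightarrow> keys (mu_dual s k \<beta> v) \<subseteq> B'"
  unfolding mu_dual_def
  by (erule keys_frag_extend_subset)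
    (intro keys_if_subset keys_diff_subset; use vpart_betak_keys[of s] in \<open>auto simp: mem_mut_set\<close>)

lemma mubar_dual_keys: "keys v \<subseteq> B' \<Longrightarrow> keys (mubar_dual s k \<beta> v) \<subseteq> basis \<Sigma>"
  unfolding mubar_dual_def
  by (erule keys_frag_extend_subset)
    (intro keys_if_subset keys_diff_subset;
      use vpart_betak_keys[of s] k_basis in \<open>auto simp: mem_mut_set\<close>)

text \<open>The coefficient of \<open>c\<close> in the image of \<open>k\<close> and the coefficient
  of \<open>k\<close> in the \<open>mubar\<close> image of \<open>c\<close> are both the signed part
  of \<beta>(k) at \<open>c\<close>; the entry -1 links \<open>k\<close> with \<open>Mu k\<close> on
  both sides.\<close>

lemma mu_dual_adjoint:
  assumes "keys u \<subseteq> basis \<Sigma>" "keys w \<subseteq> B'"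
  shows "dual_eval (mu_dual s k \<beta> u) w = dual_eval u (mubar s k \<beta> w)"
  unfolding mu_dual_def mubar_def
  by (rule frag_extend_adjoint[OF assms])
    (use Mu_notin in \<open>auto simp: mem_mut_set form_beta_def lookup_minus lookup_add lookup_frag_of\<close>)

lemma mubar_dual_adjoint:
  assumes "keys v \<subseteq> B'" "keys u \<subseteq> basis \<Sigma>"
  shows "dual_eval (mubar_dual s k \<beta> v) u = dual_eval v (mu s k \<beta> u)"
  unfolding mubar_dual_def mu_def
  by (rule frag_extend_adjoint[OF assms])
    (use Mu_notin in \<open>auto simp: mem_mut_set form_beta_def lookup_minus lookup_add lookup_frag_of\<close>)

section \<open>Closed formulas for the mutated homomorphisms\<close>

lemma mutate_sets [simp]: "basis (mutate k \<Sigma>) = B'" "exch (mutate k \<Sigma>) = ex'"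
  by (simp_all add: mutate_def)

text \<open>Adjointness moves \<open>mubar\<close> off the second argument of the pulled back form
  and so exhibits the functional that \<open>mutate\<close> describes.\<close>

lemma sbeta_mutate_Pos:
  assumes "keys v \<subseteq> ex'"
  shows "sbeta (mutate k \<Sigma>) v = mu_dual Pos k \<beta> (\<beta> (mubar Pos k \<beta> v))"
    (is "_ = ?u")
proof -
  have "keys (\<beta> (mubar Pos k \<beta> v)) \<subseteq> basis \<Sigma>"
    by (intro beta_keys mubar_keys k_exch assms)
  then show ?thesis
    unfolding mutate_def seed.simps form_beta_def
    by (intro the_dual_eval_eq mu_dual_keys mu_dual_adjoint)
qed

lemma slambda_mutate:
  assumes "keys v \<subseteq> B'"
  shows "slambda (mutate k \<Sigma>) v = mu Pos k \<beta> (\<Lambda> (mubar_dual Pos k \<beta> v))"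
    (is "_ = ?u")
proof -
  have "keys (\<Lambda> (mubar_dual Pos k \<beta> v)) \<subseteq> basis \<Sigma>"
    by (intro lambda_keys mubar_dual_keys assms)
  then show ?thesis
    unfolding mutate_def seed.simps form_lambda_def
    \<comment> \<open>The description for \<Lambda> has the unknown as second argument, so the form
      is first turned round.\<close>
    by (subst dual_eval_commute, intro the_dual_eval_eq mu_keys)
      (simp_all add: mubar_dual_adjoint dual_eval_commute[of "mu _ _ _ _"])
qed

text \<open>On a generator other than \<open>Mu k\<close> the multiples of \<open>k\<close> differ
  by the positive minus the negative part of an integer, hence by that integer. At
  \<open>Mu k\<close> the maps agree, and \<beta>(k) has no coordinate there.\<close>

lemma mubar_Pos_eq: "mubar Pos k \<beta> v = mubar Neg k \<beta> v + frag_cmul (dual_eval \<beta>k v) (frag_of k)"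
proof (rule additive_eqI[where S = UNIV and f = "mubar Pos k \<beta>"])
  fix b
  show "mubar Pos k \<beta> (frag_of b) =
      mubar Neg k \<beta> (frag_of b) + frag_cmul (dual_eval \<beta>k (frag_of b)) (frag_of k)"
    by (cases "b = Mu k")
      (simp_all add: mubar_def form_beta_def max_uminus_add flip: frag_cmul_distrib)
qed (simp_all add: mut_maps_diff frag_cmul_diff_distrib)

text \<open>\<open>mubar\<close> changes only the coordinates at \<open>k\<close> and
  \<open>Mu k\<close>, and \<beta>(k) vanishes at both.\<close>

lemma betak_mubar: "dual_eval \<beta>k (mubar s k \<beta> v) = dual_eval \<beta>k v"
  by (rule additive_eqI[where S = UNIV and f = "\<lambda>v. dual_eval \<beta>k (mubar s k \<beta> v)"])
    (simp_all add: mut_maps_diff, simp add: mubar_def)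

lemma beta_form_mubar:
  assumes v: "keys v \<subseteq> ex'"
  shows "dual_eval (\<beta> (mubar Pos k \<beta> v)) (mubar Pos k \<beta> w)
    = dual_eval (\<beta> (mubar Neg k \<beta> v)) (mubar Neg k \<beta> w)"
proof -
  let ?v = "mubar Neg k \<beta> v" and ?w = "mubar Neg k \<beta> w"
  let ?m = "dual_eval \<beta>k v" and ?n = "dual_eval \<beta>k w"
  have keys: "keys ?v \<subseteq> exch \<Sigma>" "keys (frag_cmul ?m (frag_of k)) \<subseteq> exch \<Sigma>"
    using mubar_keys[OF k_exch v] k_exch by (auto intro!: keys_cmul_subset)
  \<comment> \<open>Expanding the form at \<open>?v\<close> + \<open>?m\<close> k and
    \<open>?w\<close> + \<open>?n\<close> k leaves three corrections: - \<open>?m\<close>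
    \<open>?n\<close> by skew-symmetry, + \<open>?m\<close> \<open>?n\<close> from \<beta>(k), and a
    multiple of the vanishing value at (k, k).\<close>
  have "dual_eval (\<beta> ?v) (frag_of k) = - ?m"
    using beta_skew[OF keys(1), of "frag_of k"] k_exch by (simp add: betak_mubar del: dual_eval_of_right)
  moreover have "dual_eval (\<beta> (frag_cmul ?m (frag_of k))) u = ?m * dual_eval \<beta>k u" for u
    by (simp add: hom_frag_cmul[OF sbeta_hom] k_exch)
  moreover have "dual_eval \<beta>k (frag_of k) = 0"
    by simp
  ultimately show ?thesis
    by (simp add: mubar_Pos_eq beta_add[OF keys] betak_mubar algebra_simps del: dual_eval_of_right)
qed

lemma sbeta_mutate:
  assumes v: "keys v \<subseteq> ex'"
  shows "sbeta (mutate k \<Sigma>) v = mu_dual s k \<beta> (\<beta> (mubar s k \<beta> v))"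
proof (cases s)
  case Pos
  then show ?thesis using sbeta_mutate_Pos[OF v] by simp
next
  case Neg
  have keys: "keys (\<beta> (mubar t k \<beta> v)) \<subseteq> basis \<Sigma>" for t
    by (intro beta_keys mubar_keys k_exch v)
  have "mu_dual Pos k \<beta> (\<beta> (mubar Pos k \<beta> v)) = mu_dual Neg k \<beta> (\<beta> (mubar Neg k \<beta> v))"
  proof (rule dual_eval_eqI[of _ B'])
    fix b assume "b \<in> B'"
    then have "keys (frag_of b) \<subseteq> B'" by simp
    then show "dual_eval (mu_dual Pos k \<beta> (\<beta> (mubar Pos k \<beta> v))) (frag_of b) =
        dual_eval (mu_dual Neg k \<beta> (\<beta> (mubar Neg k \<beta> v))) (frag_of b)"
      by (simp only: mu_dual_adjoint[OF keys] beta_form_mubar[OF v])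
  qed (intro mu_dual_keys keys)+
  with sbeta_mutate_Pos[OF v] Neg show ?thesis by simp
qed

section \<open>Composites of the dual mutation maps\<close>

lemma mubar_dual_id: "keys v \<subseteq> basis \<Sigma> \<Longrightarrow> mubar_dual s k \<beta> v = v"
  unfolding mubar_dual_def by (rule frag_extend_id) (use Mu_notin in auto)

lemma mu_dual_id: "keys v \<subseteq> basis \<Sigma> - {k} \<Longrightarrow> mu_dual s k \<beta> v = v"
  unfolding mu_dual_def by (rule frag_extend_id) auto

lemma mu_dual_of_k: "mu_dual s k \<beta> (frag_of k) = vpart s \<beta>k - frag_of (Mu k)"
  by (simp add: mu_dual_def)

lemma mubar_dual_of_Mu: "mubar_dual s k \<beta> (frag_of (Mu k)) = vpart s \<beta>k - frag_of k"
  by (simp add: mubar_dual_def)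

lemma mubar_dual_vpart: "mubar_dual s k \<beta> (vpart t \<beta>k) = vpart t \<beta>k"
  using vpart_betak_keys[of t] by (intro mubar_dual_id) blast

lemma mubar_dual_mu_dual_Pos:
  assumes "keys v \<subseteq> basis \<Sigma>"
  shows "mubar_dual Pos k \<beta> (mu_dual Pos k \<beta> v) = v"
proof (rule additive_eqI[OF assms, where f = "\<lambda>v. mubar_dual Pos k \<beta> (mu_dual Pos k \<beta> v)"])
  fix b assume "b \<in> basis \<Sigma>"
  then show "mubar_dual Pos k \<beta> (mu_dual Pos k \<beta> (frag_of b)) = frag_of b"
    by (cases "b = k")
      (simp_all add: mu_dual_of_k mut_maps_diff mubar_dual_vpart mubar_dual_of_Mu mu_dual_id mubar_dual_id)
qed (simp_all add: mut_maps_diff)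

text \<open>With mixed signs the two parts of \<beta>(k) no longer cancel on \<open>k\<close>: their
  difference survives, and the composite is a transvection instead of the identity.\<close>

lemma mubar_dual_mu_dual_Neg:
  assumes "keys v \<subseteq> basis \<Sigma>"
  shows "mubar_dual Pos k \<beta> (mu_dual Neg k \<beta> v) = v - frag_cmul (lookup v k) \<beta>k"
proof (rule additive_eqI[OF assms, where f = "\<lambda>v. mubar_dual Pos k \<beta> (mu_dual Neg k \<beta> v)"])
  fix b assume b: "b \<in> basis \<Sigma>"
  show "mubar_dual Pos k \<beta> (mu_dual Neg k \<beta> (frag_of b))
      = frag_of b - frag_cmul (lookup (frag_of b) k) \<beta>k"
  proof (cases "b = k")
    case True
    have "vpart Neg \<beta>k - (vpart Pos \<beta>k - frag_of k) = frag_of k - \<beta>k"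
      by (subst (3) vpart_diff[symmetric]) simp
    with True show ?thesis
      by (simp add: mu_dual_of_k mut_maps_diff mubar_dual_vpart mubar_dual_of_Mu lookup_frag_of)
  next
    case False
    with b show ?thesis by (simp add: mu_dual_id mubar_dual_id lookup_frag_of)
  qed
qed (simp_all add: mut_maps_diff lookup_minus frag_cmul_diff_distrib)

lemma mu_dual_mubar_dual_Pos:
  assumes "keys v \<subseteq> B'"
  shows "mu_dual Pos k \<beta> (mubar_dual Pos k \<beta> v) = v"
proof (rule additive_eqI[OF assms, where f = "\<lambda>v. mu_dual Pos k \<beta> (mubar_dual Pos k \<beta> v)"])
  fix b assume "b \<in> B'"
  then show "mu_dual Pos k \<beta> (mubar_dual Pos k \<beta> (frag_of b)) = frag_of b"
    by (cases "b = Mu k")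
      (simp_all add: mem_mut_set mubar_dual_of_Mu mut_maps_diff mu_dual_id[OF vpart_betak_keys]
        mu_dual_of_k mu_dual_id mubar_dual_id)
qed (simp_all add: mut_maps_diff)

section \<open>Dual mutation as an isometry for \<Lambda>\<close>

lemma lambda_form_mutate:
  assumes "keys v \<subseteq> B'" "keys w \<subseteq> B'"
  shows "dual_eval w (slambda (mutate k \<Sigma>) v)
    = dual_eval (mubar_dual Pos k \<beta> w) (\<Lambda> (mubar_dual Pos k \<beta> v))"
  using assms by (simp add: slambda_mutate mubar_dual_adjoint lambda_keys mubar_dual_keys)

lemma lambda_form_mu_dual:
  assumes v: "keys v \<subseteq> basis \<Sigma>" and w: "keys w \<subseteq> basis \<Sigma>"
  shows "dual_eval (mu_dual s k \<beta> w) (slambda (mutate k \<Sigma>) (mu_dual s k \<beta> v)) = dual_eval w (\<Lambda> v)"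
proof (cases s)
  case Pos
  then show ?thesis
    using assms by (simp add: lambda_form_mutate mu_dual_keys mubar_dual_mu_dual_Pos)
next
  case Neg
  let ?v = "v - frag_cmul (lookup v k) \<beta>k"
  \<comment> \<open>Compatibility: pairing \<beta>(k) with \<Lambda> reads off the coordinate at
    \<open>k\<close>.\<close>
  have betak: "dual_eval \<beta>k (\<Lambda> u) = lookup u k" if "keys u \<subseteq> basis \<Sigma>" for u
    using beta_lambda[of "frag_of k" u] that k_exch by simp
  have keys: "keys ?v \<subseteq> basis \<Sigma>"
    by (intro keys_diff_subset keys_cmul_subset v betak_keys)
  have "dual_eval (w - frag_cmul (lookup w k) \<beta>k) (\<Lambda> ?v)
      = dual_eval w (\<Lambda> ?v) - lookup w k * lookup ?v k"
    using betak[OF keys] by simp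
  \<comment> \<open>Skew-symmetry transfers the correction inside \<Lambda> to the other argument,
    where it adds the product of the \<open>k\<close>-coordinates of \<open>v\<close> and
    \<open>w\<close>. This cancels the subtracted term, because \<beta>(k) has no
    \<open>k\<close>-coordinate and so \<open>?v\<close> and \<open>v\<close> agree at
    \<open>k\<close>.\<close>
  also have "\<dots> = dual_eval w (\<Lambda> v)"
    using lambda_skew[OF keys w] lambda_skew[OF v w] betak[OF w] by (simp add: lookup_minus)
  finally show ?thesis
    using assms Neg by (simp add: lambda_form_mutate mu_dual_keys mubar_dual_mu_dual_Neg)
qed

section \<open>Stability of quantum seeds under mutation\<close>

lemma mutate_skew_sbeta: "skew_symmetrizable ex' (sbeta (mutate k \<Sigma>))"
  unfolding skew_symmetrizable_def form_beta_def carrier_free_Abelian_group_iff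
proof (intro ballI)
  fix v w assume "v \<in> carrier (free_Abelian_group ex')" "w \<in> carrier (free_Abelian_group ex')"
  then have vw: "keys v \<subseteq> ex'" "keys w \<subseteq> ex'" by simp_all
  have eq: "dual_eval (sbeta (mutate k \<Sigma>) x) y = dual_eval (\<beta> (mubar Pos k \<beta> x)) (mubar Pos k \<beta> y)"
    if "keys x \<subseteq> ex'" "keys y \<subseteq> ex'" for x y
    unfolding sbeta_mutate_Pos[OF that(1)]
    using that ex'_subset by (intro mu_dual_adjoint beta_keys mubar_keys k_exch) blast+
  show "dual_eval (sbeta (mutate k \<Sigma>) v) w = - dual_eval (sbeta (mutate k \<Sigma>) w) v"
    unfolding eq[OF vw] eq[OF vw(2,1)] by (intro beta_skew mubar_keys k_exch vw)
qed

text \<open>In sign + the maps \<open>mu_dual\<close> and \<open>mubar_dual\<close> are mutually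
  inverse. The identity is carried back to the old seed, where compatibility applies, and
  adjointness returns the resulting evaluation to the new seed.\<close>

lemma mutate_compat: "compatible B' ex' (sbeta (mutate k \<Sigma>)) (slambda (mutate k \<Sigma>))"
  unfolding compatible_def
proof (intro ballI)
  fix x v assume "x \<in> carrier (free_Abelian_group ex')" "v \<in> carrier (free_Abelian_group B')"
  then have x: "keys x \<subseteq> ex'" and v: "keys v \<subseteq> B'" by simp_all
  let ?x = "mubar Pos k \<beta> x" and ?v = "mubar_dual Pos k \<beta> v"
  have x': "keys ?x \<subseteq> exch \<Sigma>" by (intro mubar_keys k_exch x)
  have v': "keys ?v \<subseteq> basis \<Sigma>" by (intro mubar_dual_keys v)
  have "dual_eval (sbeta (mutate k \<Sigma>) x) (slambda (mutate k \<Sigma>) v)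
      = dual_eval (\<beta> ?x) (\<Lambda> ?v)"
    using v beta_keys[OF x']
    by (simp add: sbeta_mutate_Pos[OF x] lambda_form_mutate mu_dual_keys mubar_dual_mu_dual_Pos)
  also have "\<dots> = dual_eval ?v ?x"
    by (rule beta_lambda[OF x' v'])
  also have "\<dots> = dual_eval v x"
    using mu_dual_adjoint[OF v', of x Pos] x ex'_subset by (simp add: mu_dual_mubar_dual_Pos[OF v])
  finally show "dual_eval (sbeta (mutate k \<Sigma>) x) (slambda (mutate k \<Sigma>) v) = dual_eval v x" .
qed

lemma quantum_seed_mutate: "quantum_seed (mutate k \<Sigma>)"
proof
  \<comment> \<open>\<open>Mu k\<close> takes over the origin of the removed \<open>k\<close>, and
    no other basis element has that origin.\<close>
  show "inj_on origin (basis (mutate k \<Sigma>))"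
    using inj_origin k_basis by (auto simp: inj_on_def mem_mut_set)
  show "sbeta (mutate k \<Sigma>) \<in>
      hom (free_Abelian_group (exch (mutate k \<Sigma>))) (free_Abelian_group (basis (mutate k \<Sigma>)))"
    unfolding mutate_sets
    by (rule free_Abelian_group_homI)
      (simp_all add: sbeta_mutate_Pos mu_dual_keys beta_keys mubar_keys k_exch keys_add_subset
        mut_maps_add beta_add)
  show "slambda (mutate k \<Sigma>) \<in>
      hom (free_Abelian_group (basis (mutate k \<Sigma>))) (free_Abelian_group (basis (mutate k \<Sigma>)))"
    unfolding mutate_sets
    by (rule free_Abelian_group_homI)
      (simp_all add: slambda_mutate mu_keys lambda_keys mubar_dual_keys keys_add_subset
        mut_maps_add lambda_add)
  show "skew_symmetric (basis (mutate k \<Sigma>)) (slambda (mutate k \<Sigma>))"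
    unfolding skew_symmetric_def mutate_sets
    by (auto simp: lambda_form_mutate intro!: lambda_skew mubar_dual_keys)
qed (use ex'_subset mutate_skew_sbeta mutate_compat in simp_all)

end

lemma quantum_seed_mutate_seq:
  assumes "quantum_seed \<Sigma>" "admissible \<Sigma> ks"
  shows "quantum_seed (mutate_seq ks \<Sigma>)"
  using assms(2)
proof (induction ks)
  case Nil
  then show ?case using assms(1) by simp
next
  case (Cons k ks)
  then interpret seed_mutation "mutate_seq ks \<Sigma>" k
    by (simp add: seed_mutation_def seed_mutation_axioms_def)
  show ?case using quantum_seed_mutate by simp
qed

section \<open>The initial seed\<close>

lemma unlabel_relabel [simp]: "unlabel (relabel v) = v"
  by (rule additive_eqI[where S = UNIV and f = "\<lambda>v. unlabel (relabel v)"])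
    (simp_all add: unlabel_def relabel_def frag_extend_diff)

text \<open>\<open>unlabel\<close> kills every symbol \<open>Mu\<close>, hence the restriction on
  the support.\<close>

lemma relabel_unlabel:
  assumes "keys v \<subseteq> Init ` S"
  shows "relabel (unlabel v) = v"
  by (rule additive_eqI[OF assms, where f = "\<lambda>v. relabel (unlabel v)"])
    (auto simp: unlabel_def relabel_def frag_extend_diff)

text \<open>Renaming and its left inverse are transposes, so conditions on forms pass to the renamed
  data by evaluating at unlabelled vectors.\<close>

lemma dual_eval_relabel: "dual_eval (relabel v) w = dual_eval v (unlabel w)"
  unfolding relabel_def unlabel_def
  by (rule frag_extend_adjoint[where S = UNIV and T = UNIV])
    (auto simp: lookup_frag_of split: symb.split)

lemma dual_eval_relabel_right: "dual_eval w (relabel v) = dual_eval (unlabel w) v"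
  by (simp only: dual_eval_commute[of w] dual_eval_relabel dual_eval_commute[of v])

lemma relabel_keys: "keys v \<subseteq> S \<Longrightarrow> keys (relabel v) \<subseteq> Init ` S"
  unfolding relabel_def by (erule keys_frag_extend_subset) auto

lemma unlabel_keys: "keys v \<subseteq> Init ` S \<Longrightarrow> keys (unlabel v) \<subseteq> S"
  unfolding unlabel_def by (erule keys_frag_extend_subset) auto

lemma relabel_hom:
  assumes f: "f \<in> hom (free_Abelian_group S) (free_Abelian_group T)"
  shows "relabel \<circ> f \<circ> unlabel \<in>
    hom (free_Abelian_group (Init ` S)) (free_Abelian_group (Init ` T))"
proof (rule free_Abelian_group_homI)
  fix x y :: "'a symb \<Rightarrow>\<^sub>0 int" assume "keys x \<subseteq> Init ` S" "keys y \<subseteq> Init ` S"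
  then show "(relabel \<circ> f \<circ> unlabel) (x + y) = (relabel \<circ> f \<circ> unlabel) x + (relabel \<circ> f \<circ> unlabel) y"
    using hom_frag_add[OF f unlabel_keys unlabel_keys, of x y]
    by (simp add: relabel_def unlabel_def frag_extend_add)
qed (simp add: relabel_keys hom_keys[OF f] unlabel_keys)

context quantum_cluster_data
begin

lemma quantum_seed_initial: "quantum_seed (initial_seed B ex \<beta> \<Lambda>)"
proof
  show "exch (initial_seed B ex \<beta> \<Lambda>) \<subseteq> basis (initial_seed B ex \<beta> \<Lambda>)"
    using ex_subset by (auto simp: initial_seed_def)
  show "inj_on origin (basis (initial_seed B ex \<beta> \<Lambda>))"
    by (auto simp: initial_seed_def inj_on_def)
  show "skew_symmetrizable (exch (initial_seed B ex \<beta> \<Lambda>)) (sbeta (initial_seed B ex \<beta> \<Lambda>))"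
    unfolding skew_symmetrizable_def
  proof (intro ballI)
    fix v w assume "v \<in> carrier (free_Abelian_group (exch (initial_seed B ex \<beta> \<Lambda>)))"
      "w \<in> carrier (free_Abelian_group (exch (initial_seed B ex \<beta> \<Lambda>)))"
    then have "keys (unlabel v) \<subseteq> ex" "keys (unlabel w) \<subseteq> ex"
      by (simp_all add: initial_seed_def unlabel_keys)
    then show "form_beta (sbeta (initial_seed B ex \<beta> \<Lambda>)) v w =
        - form_beta (sbeta (initial_seed B ex \<beta> \<Lambda>)) w v"
      using beta_skew[unfolded skew_symmetrizable_def, rule_format, of "unlabel v" "unlabel w"]
      by (simp add: initial_seed_def form_beta_def dual_eval_relabel)
  qed
  show "skew_symmetric (basis (initial_seed B ex \<beta> \<Lambda>)) (slambda (initial_seed B ex \<beta> \<Lambda>))"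
    unfolding skew_symmetric_def
  proof (intro ballI)
    fix v w assume "v \<in> carrier (free_Abelian_group (basis (initial_seed B ex \<beta> \<Lambda>)))"
      "w \<in> carrier (free_Abelian_group (basis (initial_seed B ex \<beta> \<Lambda>)))"
    then have "keys (unlabel v) \<subseteq> B" "keys (unlabel w) \<subseteq> B"
      by (simp_all add: initial_seed_def unlabel_keys)
    then show "dual_eval w (slambda (initial_seed B ex \<beta> \<Lambda>) v) =
        - dual_eval v (slambda (initial_seed B ex \<beta> \<Lambda>) w)"
      using lambda_skew[unfolded skew_symmetric_def, rule_format, of "unlabel v" "unlabel w"]
      by (simp add: initial_seed_def dual_eval_relabel_right)
  qed
  show "compatible (basis (initial_seed B ex \<beta> \<Lambda>)) (exch (initial_seed B ex \<beta> \<Lambda>))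
      (sbeta (initial_seed B ex \<beta> \<Lambda>)) (slambda (initial_seed B ex \<beta> \<Lambda>))"
    unfolding compatible_def
  proof (intro ballI)
    fix x v assume "x \<in> carrier (free_Abelian_group (exch (initial_seed B ex \<beta> \<Lambda>)))"
      "v \<in> carrier (free_Abelian_group (basis (initial_seed B ex \<beta> \<Lambda>)))"
    then have x: "keys x \<subseteq> Init ` ex" and v: "keys v \<subseteq> Init ` B"
      by (simp_all add: initial_seed_def)
    have "dual_eval (sbeta (initial_seed B ex \<beta> \<Lambda>) x) (slambda (initial_seed B ex \<beta> \<Lambda>) v)
        = dual_eval (\<beta> (unlabel x)) (\<Lambda> (unlabel v))"
      by (simp add: initial_seed_def dual_eval_relabel)
    also have "\<dots> = dual_eval (unlabel v) (unlabel x)"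
      using beta_lambda_compatible unlabel_keys[OF x] unlabel_keys[OF v]
      unfolding compatible_def by simp
    also have "\<dots> = dual_eval v x"
      using dual_eval_relabel[of "unlabel v" x] relabel_unlabel[OF v] by simp
    finally show "dual_eval (sbeta (initial_seed B ex \<beta> \<Lambda>) x)
        (slambda (initial_seed B ex \<beta> \<Lambda>) v) = dual_eval v x" .
  qed
qed (use relabel_hom beta_hom lambda_hom in \<open>auto simp: initial_seed_def\<close>)

end

section \<open>The exchange tree\<close>

lemma exchange_tree_simps [simp]:
  "ks \<in> pverts (exchange_tree \<Sigma>) \<longleftrightarrow> admissible \<Sigma> ks"
  "(ks, ls) \<in> parcs (exchange_tree \<Sigma>) \<longleftrightarrow> (\<exists>k. ls = k # ks \<and> admissible \<Sigma> ls)"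
  by (auto simp: exchange_tree_def)

lemma pair_loopfree_exchange_tree: "pair_loopfree_digraph (exchange_tree \<Sigma>)"
  by unfold_locales (auto simp: exchange_tree_def)


context
  fixes \<Sigma> :: "'b symb seed"
begin

text \<open>Each arrow lengthens the sequence by one, so no arrow has a reverse.\<close>

interpretation exchange_tree: no_2_cycle_digraph "exchange_tree \<Sigma>"
  by unfold_locales (auto simp: exchange_tree_def)

section \<open>The sheaves and forms on the exchange tree\<close>

definition tree_exch :: "'b symb list \<Rightarrow> ('b symb \<Rightarrow>\<^sub>0 int) monoid" where
  "tree_exch ks = free_Abelian_group (exch (mutate_seq ks \<Sigma>))"

definition tree_basis :: "'b symb list \<Rightarrow> ('b symb \<Rightarrow>\<^sub>0 int) monoid" where
  "tree_basis ks = free_Abelian_group (basis (mutate_seq ks \<Sigma>))"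

text \<open>The target of an arrow has the form \<open>k # ks\<close>, so its head is the mutation
  direction. Although this map starts at the target lattice, it is built from the \<beta> of the
  source.\<close>

fun tree_mubar :: "'b symb list sarrow \<Rightarrow> ('b symb \<Rightarrow>\<^sub>0 int) \<Rightarrow> ('b symb \<Rightarrow>\<^sub>0 int)" where
  "tree_mubar (ks, s, ls) = mubar s (hd ls) (sbeta (mutate_seq ks \<Sigma>))"

fun tree_mu_dual :: "'b symb list sarrow \<Rightarrow> ('b symb \<Rightarrow>\<^sub>0 int) \<Rightarrow> ('b symb \<Rightarrow>\<^sub>0 int)" where
  "tree_mu_dual (ks, s, ls) = mu_dual s (hd ls) (sbeta (mutate_seq ks \<Sigma>))"

text \<open>The restriction makes the functional extensional, as membership in
  \<open>dual_group\<close> demands.\<close>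

definition tree_lambda :: "'b symb list \<Rightarrow> ('b symb \<Rightarrow>\<^sub>0 int) \<Rightarrow> ('b symb \<Rightarrow>\<^sub>0 int) \<Rightarrow> int" where
  "tree_lambda ks v =
    restrict (\<lambda>w. dual_eval w (slambda (mutate_seq ks \<Sigma>) v)) (carrier (tree_basis ks))"

text \<open>The witness for the retraction in the quantum structure.\<close>

definition tree_lambda_transpose ::
    "'b symb list \<Rightarrow> ('b symb \<Rightarrow>\<^sub>0 int) \<Rightarrow> ('b symb \<Rightarrow>\<^sub>0 int) \<Rightarrow> int" where
  "tree_lambda_transpose ks v =
    restrict (\<lambda>w. dual_eval v (slambda (mutate_seq ks \<Sigma>) w)) (carrier (tree_basis ks))"

abbreviation (input) "tree_cat \<equiv> signed_path_category (exchange_tree \<Sigma>)"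
abbreviation (input) "exch_sheaf \<equiv> contra_functor tree_exch tree_mubar"
abbreviation (input) "basis_sheaf \<equiv> cov_functor tree_basis tree_mu_dual"
abbreviation (input) "tree_beta ks \<equiv> sbeta (mutate_seq ks \<Sigma>)"

context
  assumes seed: "quantum_seed \<Sigma>"
begin

lemma carrier_tree [simp]:
  "v \<in> carrier (tree_basis ks) \<longleftrightarrow> keys v \<subseteq> basis (mutate_seq ks \<Sigma>)"
  "v \<in> carrier (tree_exch ks) \<longleftrightarrow> keys v \<subseteq> exch (mutate_seq ks \<Sigma>)"
  by (simp_all add: tree_basis_def tree_exch_def)

lemma quantum_seed_tree: "admissible \<Sigma> ks \<Longrightarrow> quantum_seed (mutate_seq ks \<Sigma>)"
  by (rule quantum_seed_mutate_seq[OF seed])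

lemma seed_mutation_tree:
  assumes "(ks, ls) \<in> parcs (exchange_tree \<Sigma>)"
  obtains k where "ls = k # ks" "seed_mutation (mutate_seq ks \<Sigma>) k"
proof -
  from assms obtain k where k: "ls = k # ks" "admissible \<Sigma> ls" by auto
  then have "seed_mutation (mutate_seq ks \<Sigma>) k"
    by (simp add: seed_mutation_def seed_mutation_axioms_def quantum_seed_tree)
  with k show ?thesis using that by simp
qed

lemma tree_mubar_hom:
  assumes "(ks, ls) \<in> parcs (exchange_tree \<Sigma>)"
  shows "tree_mubar (ks, s, ls) \<in> hom (tree_exch ls) (tree_exch ks)"
proof -
  obtain k where k: "ls = k # ks" "seed_mutation (mutate_seq ks \<Sigma>) k"
    using seed_mutation_tree[OF assms] by metis
  interpret seed_mutation "mutate_seq ks \<Sigma>" k by fact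
  show ?thesis
    unfolding tree_exch_def k(1)
    by (rule free_Abelian_group_homI) (simp_all add: mubar_keys k_exch mut_maps_add)
qed

lemma tree_mu_dual_hom:
  assumes "(ks, ls) \<in> parcs (exchange_tree \<Sigma>)"
  shows "tree_mu_dual (ks, s, ls) \<in> hom (tree_basis ks) (tree_basis ls)"
proof -
  obtain k where k: "ls = k # ks" "seed_mutation (mutate_seq ks \<Sigma>) k"
    using seed_mutation_tree[OF assms] by metis
  interpret seed_mutation "mutate_seq ks \<Sigma>" k by fact
  show ?thesis
    unfolding tree_basis_def k(1)
    by (rule free_Abelian_group_homI) (simp_all add: mu_dual_keys mut_maps_add)
qed

lemma tree_lambda_mu_dual:
  assumes "(ks, ls) \<in> parcs (exchange_tree \<Sigma>)"
    and "v \<in> carrier (tree_basis ks)" "w \<in> carrier (tree_basis ks)"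
  shows "dual_eval (tree_mu_dual (ks, s, ls) w)
      (slambda (mutate_seq ls \<Sigma>) (tree_mu_dual (ks, s, ls) v))
    = dual_eval w (slambda (mutate_seq ks \<Sigma>) v)"
proof -
  obtain k where k: "ls = k # ks" "seed_mutation (mutate_seq ks \<Sigma>) k"
    using seed_mutation_tree[OF assms(1)] by metis
  interpret seed_mutation "mutate_seq ks \<Sigma>" k by fact
  show ?thesis
    using assms(2,3) by (simp add: k(1) lambda_form_mu_dual)
qed

section \<open>Verification of the axioms\<close>

lemma factorization_tree_beta: "factorization_contra_cov tree_cat exch_sheaf basis_sheaf tree_beta"
proof (rule exchange_tree.factorization_contra_cov_functors
    [where X = tree_exch and mX = tree_mubar, OF tree_mubar_hom])
  fix ks assume "ks \<in> pverts (exchange_tree \<Sigma>)"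
  then interpret quantum_seed "mutate_seq ks \<Sigma>" by (simp add: quantum_seed_tree)
  show "tree_beta ks \<in> hom (tree_exch ks) (tree_basis ks)"
    unfolding tree_exch_def tree_basis_def by (rule sbeta_hom)
next
  fix ks s ls x
  assume arc: "(ks, ls) \<in> parcs (exchange_tree \<Sigma>)" and x: "x \<in> carrier (tree_exch ls)"
  obtain k where k: "ls = k # ks" "seed_mutation (mutate_seq ks \<Sigma>) k"
    using seed_mutation_tree[OF arc] by metis
  interpret seed_mutation "mutate_seq ks \<Sigma>" k by fact
  show "tree_beta ls x = tree_mu_dual (ks, s, ls) (tree_beta ks (tree_mubar (ks, s, ls) x))"
    using x sbeta_mutate[of x s] by (simp add: k(1))
qed

lemma right_nondegenerate_tree_pairing:
  "right_nondegenerate_pairing tree_cat basis_sheaf exch_sheaf (\<lambda>ks. dual_eval)"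
proof (rule exchange_tree.right_nondegenerate_pairing_functors
    [where A = tree_basis and mA = tree_mu_dual and X = tree_exch and mX = tree_mubar,
      OF tree_mu_dual_hom tree_mubar_hom])
  fix ks x assume "ks \<in> pverts (exchange_tree \<Sigma>)"
  then interpret quantum_seed "mutate_seq ks \<Sigma>" by (simp add: quantum_seed_tree)
  show "(\<lambda>a. dual_eval a x) \<in> hom (tree_basis ks) integer_group"
    by (simp add: hom_def tree_basis_def)
  show "dual_eval a \<in> hom (tree_exch ks) integer_group" for a
    by (simp add: hom_def tree_exch_def)
  show "inj_on (pairing_map basis_sheaf (\<lambda>ks. dual_eval) ks) (carrier (tree_exch ks))"
  proof (rule inj_onI)
    fix x y
    assume xy: "x \<in> carrier (tree_exch ks)" "y \<in> carrier (tree_exch ks)"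
      and eq: "pairing_map basis_sheaf (\<lambda>ks. dual_eval) ks x =
        pairing_map basis_sheaf (\<lambda>ks. dual_eval) ks y"
    show "x = y"
    proof (rule dual_eval_eqI)
      fix b assume "b \<in> exch (mutate_seq ks \<Sigma>)"
      \<comment> \<open>Both vectors are supported on exchangeable elements, whose dual basis
        vectors are available as tests because they belong to the basis.\<close>
      then have "frag_of b \<in> carrier (tree_basis ks)" using exch_subset by auto
      then show "dual_eval x (frag_of b) = dual_eval y (frag_of b)"
        using fun_cong[OF eq, of "frag_of b"] by (simp add: pairing_map_def)
    qed (use xy in simp_all)
  qed
next
  fix ks s ls a x
  assume arc: "(ks, ls) \<in> parcs (exchange_tree \<Sigma>)"
    and a: "a \<in> carrier (tree_basis ks)" and x: "x \<in> carrier (tree_exch ls)"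
  obtain k where k: "ls = k # ks" "seed_mutation (mutate_seq ks \<Sigma>) k"
    using seed_mutation_tree[OF arc] by metis
  interpret seed_mutation "mutate_seq ks \<Sigma>" k by fact
  show "dual_eval a (tree_mubar (ks, s, ls) x) = dual_eval (tree_mu_dual (ks, s, ls) a) x"
    using a x ex'_subset mu_dual_adjoint[of a x s] by (simp add: k(1))
qed

lemma free_abelian_sheaves_tree:
  "free_abelian_sheaf (op_category tree_cat) exch_sheaf" "free_abelian_sheaf tree_cat basis_sheaf"
  unfolding free_abelian_sheaf_def
  using exchange_tree.ab_functor_contra_functor[of tree_exch tree_mubar]
    exchange_tree.ab_functor_cov_functor[of tree_basis tree_mu_dual]
    tree_mubar_hom tree_mu_dual_hom
  by (auto simp: tree_exch_def tree_basis_def abelian_free_Abelian_group)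

lemma tree_lambda_hom:
  assumes "admissible \<Sigma> ks"
  shows "tree_lambda ks \<in> hom (tree_basis ks) (dual_group (tree_basis ks))"
    and "tree_lambda_transpose ks \<in> hom (tree_basis ks) (dual_group (tree_basis ks))"
proof -
  interpret quantum_seed "mutate_seq ks \<Sigma>" by (rule quantum_seed_tree[OF assms])
  show "tree_lambda ks \<in> hom (tree_basis ks) (dual_group (tree_basis ks))"
    unfolding tree_lambda_def tree_basis_def by (rule lambda_hom_dual_group)
  show "tree_lambda_transpose ks \<in> hom (tree_basis ks) (dual_group (tree_basis ks))"
    unfolding tree_lambda_transpose_def tree_basis_def by (rule lambda_transpose_hom_dual_group)
qed

lemma factorization_tree_lambda:
  "factorization_cov_contra tree_cat basis_sheaf (dual_functor tree_cat basis_sheaf) tree_lambda"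
  "factorization_cov_contra tree_cat basis_sheaf (dual_functor tree_cat basis_sheaf)
    tree_lambda_transpose"
proof -
  \<comment> \<open>The restricted forms at \<open>ls\<close> can be evaluated only on arguments in
    the carrier at \<open>ls\<close>.\<close>
  have closed: "keys (tree_mu_dual (ks, s, ls) v) \<subseteq> basis (mutate_seq ls \<Sigma>)"
    if "(ks, ls) \<in> parcs (exchange_tree \<Sigma>)" "v \<in> carrier (tree_basis ks)" for ks s ls v
    using hom_in_carrier[OF tree_mu_dual_hom[OF that(1)] that(2)] by simp
  show "factorization_cov_contra tree_cat basis_sheaf (dual_functor tree_cat basis_sheaf) tree_lambda"
    by (rule exchange_tree.factorization_cov_dual_functor
        [where A = tree_basis and mA = tree_mu_dual, OF tree_mu_dual_hom])
      (use tree_lambda_hom closed tree_lambda_mu_dual in \<open>simp_all add: tree_lambda_def\<close>)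
  show "factorization_cov_contra tree_cat basis_sheaf (dual_functor tree_cat basis_sheaf)
    tree_lambda_transpose"
    by (rule exchange_tree.factorization_cov_dual_functor
        [where A = tree_basis and mA = tree_mu_dual, OF tree_mu_dual_hom])
      (use tree_lambda_hom closed tree_lambda_mu_dual in \<open>simp_all add: tree_lambda_transpose_def\<close>)
qed

lemma quantum_structure_tree:
  "quantum_structure tree_cat exch_sheaf tree_beta tree_lambda basis_sheaf (\<lambda>ks. dual_eval)"
  unfolding quantum_structure_def dual_retraction_def
proof (intro conjI exI[of _ tree_lambda_transpose] ballI factorization_tree_lambda)
  fix ks x assume "ks \<in> Obj tree_cat" and x: "x \<in> carrier (fobj exch_sheaf ks)"
  then interpret quantum_seed "mutate_seq ks \<Sigma>" by (simp add: quantum_seed_tree)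
  \<comment> \<open>Evaluated at a vector of the dual lattice, this is compatibility of the seed at
    \<open>ks\<close>, which persists along admissible sequences.\<close>
  show "tree_lambda_transpose ks (tree_beta ks x) = pairing_map basis_sheaf (\<lambda>ks. dual_eval) ks x"
    using x unfolding tree_lambda_transpose_def pairing_map_def
    by (auto simp: beta_lambda intro!: restrict_ext)
qed (simp add: tree_lambda_def tree_lambda_transpose_def)

lemma abstract_quantum_cluster_structure_tree:
  "abstract_quantum_cluster_structure (exchange_tree \<Sigma>) tree_cat
    exch_sheaf tree_beta tree_lambda basis_sheaf (\<lambda>ks. dual_eval)"
  unfolding abstract_quantum_cluster_structure_def abstract_cluster_structure_def
  using pair_loopfree_exchange_tree free_abelian_sheaves_tree factorization_tree_beta
    right_nondegenerate_tree_pairing quantum_structure_tree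
  by blast

text \<open>A signed arrow is the class of a path of length one, so folding along it performs a
  single step.\<close>

lemma farr_tree_signed_arrow:
  assumes "admissible \<Sigma> (k # ks)"
  shows "farr exch_sheaf (signed_arrow (exchange_tree \<Sigma>) s ks (k # ks)) = mubar s k (tree_beta ks)"
    and "farr basis_sheaf (signed_arrow (exchange_tree \<Sigma>) s ks (k # ks)) = mu_dual s k (tree_beta ks)"
  using assms by (simp_all add: exchange_tree.signed_arrow_eq)

end

end

theorem theorem4p36:
  fixes B ex iv :: "'b set"
    and \<beta> \<Lambda> :: "('b \<Rightarrow>\<^sub>0 int) \<Rightarrow> ('b \<Rightarrow>\<^sub>0 int)"
    and K :: "('k, 'more) ring_scheme" and qh :: 'k
    and \<Sigma> :: "'b symb seed"
  assumes "quantum_cluster_data B ex iv \<beta> \<Lambda> K qh"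
    and "\<Sigma> = initial_seed B ex \<beta> \<Lambda>"
  shows "\<exists>\<E> X \<beta>' \<Lambda>' A P.
    abstract_quantum_cluster_structure (exchange_tree \<Sigma>) \<E> X \<beta>' \<Lambda>' A P \<and>
    \<E> = signed_path_category (exchange_tree \<Sigma>) \<and>
    (\<forall>ks. admissible \<Sigma> ks \<longrightarrow>
       fobj X ks = free_Abelian_group (exch (mutate_seq ks \<Sigma>))) \<and>
    (\<forall>s k ks. admissible \<Sigma> (k # ks) \<longrightarrow>
       (\<forall>x\<in>carrier (free_Abelian_group (exch (mutate_seq (k # ks) \<Sigma>))).
          farr X (signed_arrow (exchange_tree \<Sigma>) s ks (k # ks)) x
            = mubar s k (sbeta (mutate_seq ks \<Sigma>)) x)) \<and>
    (\<forall>ks. admissible \<Sigma> ks \<longrightarrow>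
       (\<forall>x\<in>carrier (free_Abelian_group (exch (mutate_seq ks \<Sigma>))).
          \<beta>' ks x = sbeta (mutate_seq ks \<Sigma>) x)) \<and>
    (\<forall>ks. admissible \<Sigma> ks \<longrightarrow>
       (\<forall>v\<in>carrier (free_Abelian_group (basis (mutate_seq ks \<Sigma>))).
        \<forall>w\<in>carrier (free_Abelian_group (basis (mutate_seq ks \<Sigma>))).
          \<Lambda>' ks v w = dual_eval w (slambda (mutate_seq ks \<Sigma>) v))) \<and>
    (\<forall>ks. admissible \<Sigma> ks \<longrightarrow>
       fobj A ks = free_Abelian_group (basis (mutate_seq ks \<Sigma>))) \<and>
    (\<forall>s k ks. admissible \<Sigma> (k # ks) \<longrightarrow>
       (\<forall>v\<in>carrier (free_Abelian_group (basis (mutate_seq ks \<Sigma>))).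
          farr A (signed_arrow (exchange_tree \<Sigma>) s ks (k # ks)) v
            = mu_dual s k (sbeta (mutate_seq ks \<Sigma>)) v)) \<and>
    (\<forall>ks. admissible \<Sigma> ks \<longrightarrow>
       (\<forall>b\<in>basis (mutate_seq ks \<Sigma>). \<forall>c\<in>exch (mutate_seq ks \<Sigma>).
          P ks (frag_of b) (frag_of c) = dual_eval (frag_of b) (frag_of c)))"
proof -
  interpret quantum_cluster_data B ex iv \<beta> \<Lambda> K qh by fact
  have seed: "quantum_seed \<Sigma>"
    unfolding assms(2) by (rule quantum_seed_initial)
  let ?X = "contra_functor (tree_exch \<Sigma>) (tree_mubar \<Sigma>)"
  let ?A = "cov_functor (tree_basis \<Sigma>) (tree_mu_dual \<Sigma>)"
  show ?thesis
  proof (intro exI conjI)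
    \<comment> \<open>Stating this clause explicitly fixes the witnesses left open by
      \<open>exI\<close>; the remaining clauses then hold by construction.\<close>
    show "abstract_quantum_cluster_structure (exchange_tree \<Sigma>)
        (signed_path_category (exchange_tree \<Sigma>)) ?X (\<lambda>ks. sbeta (mutate_seq ks \<Sigma>))
        (tree_lambda \<Sigma>) ?A (\<lambda>ks. dual_eval)"
      by (rule abstract_quantum_cluster_structure_tree[OF seed])
  qed (simp_all add: farr_tree_signed_arrow[OF seed] tree_exch_def tree_basis_def tree_lambda_def
      del: mutate_seq.simps)
qed


end
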